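(* Let $G$ be a non-empty saturated graph. Then the poset $(\mathcal{G}(G), \triangleleft)$ has a minimum element, say $G_0$, and it satisfies $\mathcal{P}_G(G_0)=\mathcal{P}(G_0)=:\mathcal{P}_0$. Additionally, for each $S\in\mathcal{P}_0$ there is at most one connected component $K$ of $G-V(G_0)$ such that $N_G(K)\subseteq S$; let $G_S$ be this component if it exists, and the empty graph otherwise. Then $G$ is the graph obtained from the foundation $G_0$ and the family of towers $\mathcal{T}:=\{G_S\}_{S\in\mathcal{P}_0}$ by the cathedral construction.
   Context: Graphs are finite. A graph is factorizable if it has a perfect matching. A factorizable graph $G$ is saturated if $G+xy$ has more perfect matchings than $G$ for every complement edge $xy$, i.e. for every pair of distinct vertices $x,y\in V(G)$ not joined by an edge of $G$. Empty graphs are treated as factorizable and saturated. For $Y\subseteq V(G)$ (or a subgraph, identified with its vertex set), $N_G(Y)$ is the set of vertices of $V(G)\setminus Y$ adjacent to some vertex of $Y$. An edge of a factorizable graph $G$ is allowed if some perfect matching of $G$ contains it. A connected component of the subgraph of $G$ determined by all allowed edges is an elementary component of $G$; for each elementary component $H$, the induced subgraph $G[V(H)]$ is called a factor-connected component of $G$. $\mathcal{G}(G)$ denotes the set of all factor-connected components of $G$; their vertex sets partition $V(G)$. A factorizable graph with exactly one elementary component is called elementary; every factor-connected component is elementary. A set $X\subseteq V(G)$ is separating if every $H\in\mathcal{G}(G)$ satisfies $V(H)\subseteq X$ or $V(H)\cap X=\emptyset$. A graph is factor-critical if deleting any one vertex leaves a factorizable graph (a one-vertex graph is regarded as factor-critical).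 $G[X]/Y$ denotes the graph obtained from $G[X]$ by contracting $Y$ to a single vertex. For $G_1,G_2\in\mathcal{G}(G)$, write $G_1\triangleleft G_2$ if there is a separating set $X\subseteq V(G)$ with $V(G_1)\cup V(G_2)\subseteq X$ such that $G[X]/V(G_1)$ is factor-critical. It is known that $\triangleleft$ is a partial order on $\mathcal{G}(G)$. For $u,v\in V(G)$, write $u\sim_G v$ if $u,v$ lie in the same factor-connected component of $G$ and either $u=v$ or $G-u-v$ is not factorizable. It is known that $\sim_G$ is an equivalence relation; $\mathcal{P}(G):=V(G)/\!\sim_G$ is the generalized canonical partition. For $H\in\mathcal{G}(G)$, $\mathcal{P}_G(H):=\{S\in\mathcal{P}(G): S\subseteq V(H)\}$, a partition of $V(H)$. ($\mathcal{P}(H)$ is the partition defined by $\sim_H$ for the graph $H$ itself.) Cathedral construction: given a saturated elementary graph $G_0$ (the foundation) and a family $\{G_S\}_{S\in\mathcal{P}(G_0)}$ of saturated graphs, some possibly empty (the towers), all pairwise vertex-disjoint, join, for each $S\in\mathcal{P}(G_0)$, every vertex of $S$ to every vertex of $G_S$ by an edge. Saying that a graph is obtained by the cathedral construction from given graphs includes that these graphs are a legitimate foundation and family of towers. *)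

theory Defs
  imports Main
begin

record 'a ugraph =
  gverts :: "'a set"
  gedges :: "'a set set"

definition simple_graph :: "'a ugraph \<Rightarrow> bool" where
  "simple_graph G \<longleftrightarrow> finite (gverts G) \<and> (\<forall>e\<in>gedges G. e \<subseteq> gverts G \<and> card e = 2)"

definition empty_graph :: "'a ugraph" where
  "empty_graph = \<lparr>gverts = {}, gedges = {}\<rparr>"

definition induced :: "'a ugraph \<Rightarrow> 'a set \<Rightarrow> 'a ugraph" where
  "induced G X = \<lparr>gverts = gverts G \<inter> X, gedges = {e \<in> gedges G. e \<subseteq> X}\<rparr>"

definition delete_verts :: "'a ugraph \<Rightarrow> 'a set \<Rightarrow> 'a ugraph" where
  "delete_verts G X = induced G (gverts G - X)"

definition add_edge :: "'a ugraph \<Rightarrow> 'a \<Rightarrow> 'a \<Rightarrow> 'a ugraph" where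
  "add_edge G x y = G\<lparr>gedges := insert {x, y} (gedges G)\<rparr>"

definition neighbours :: "'a ugraph \<Rightarrow> 'a set \<Rightarrow> 'a set" where
  "neighbours G Y = {v \<in> gverts G - Y. \<exists>y\<in>Y. {v, y} \<in> gedges G}"

text \<open>The contracted vertex is \<open>None\<close>; edges inside \<open>Y\<close>, which would become loops, disappear,
  and parallel edges are merged (neither affects the existence of perfect matchings).\<close>

definition contract :: "'a ugraph \<Rightarrow> 'a set \<Rightarrow> 'a option ugraph" where
  "contract G Y =
    \<lparr>gverts = insert None (Some ` (gverts G - Y)),
     gedges = {(\<lambda>v. if v \<in> Y then None else Some v) ` e | e. e \<in> gedges G \<and> \<not> e \<subseteq> Y}\<rparr>"

definition adjacency :: "'a ugraph \<Rightarrow> ('a \<times> 'a) set" where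
  "adjacency G = {(u, v). u \<in> gverts G \<and> v \<in> gverts G \<and> {u, v} \<in> gedges G}"

definition conn_components :: "'a ugraph \<Rightarrow> 'a ugraph set" where
  "conn_components G = {induced G ((adjacency G)\<^sup>* `` {v}) | v. v \<in> gverts G}"

definition perfect_matching :: "'a ugraph \<Rightarrow> 'a set set \<Rightarrow> bool" where
  "perfect_matching G M \<longleftrightarrow> M \<subseteq> gedges G \<and> (\<forall>v\<in>gverts G. \<exists>!e. e \<in> M \<and> v \<in> e)"

definition factorizable :: "'a ugraph \<Rightarrow> bool" where
  "factorizable G \<longleftrightarrow> (\<exists>M. perfect_matching G M)"

definition saturated :: "'a ugraph \<Rightarrow> bool" where
  "saturated G \<longleftrightarrow> factorizable G \<and>
    (\<forall>x\<in>gverts G. \<forall>y\<in>gverts G. x \<noteq> y \<and> {x, y} \<notin> gedges G \<longrightarrow>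
      card {M. perfect_matching G M} < card {M. perfect_matching (add_edge G x y) M})"

lemma saturated_empty_graph: "saturated empty_graph"
  by (simp add: saturated_def factorizable_def perfect_matching_def empty_graph_def)

definition allowed_edges :: "'a ugraph \<Rightarrow> 'a set set" where
  "allowed_edges G = {e \<in> gedges G. \<exists>M. perfect_matching G M \<and> e \<in> M}"

definition elementary_components :: "'a ugraph \<Rightarrow> 'a ugraph set" where
  "elementary_components G =
    conn_components \<lparr>gverts = \<Union> (allowed_edges G), gedges = allowed_edges G\<rparr>"

definition factor_components :: "'a ugraph \<Rightarrow> 'a ugraph set" where
  "factor_components G = {induced G (gverts H) | H. H \<in> elementary_components G}"

definition elementary :: "'a ugraph \<Rightarrow> bool" where
  "elementary G \<longleftrightarrow> factorizable G \<and> (\<exists>!H. H \<in> elementary_components G)"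

definition separating :: "'a ugraph \<Rightarrow> 'a set \<Rightarrow> bool" where
  "separating G X \<longleftrightarrow> X \<subseteq> gverts G \<and>
    (\<forall>H\<in>factor_components G. gverts H \<subseteq> X \<or> gverts H \<inter> X = {})"

definition factor_critical :: "'a ugraph \<Rightarrow> bool" where
  "factor_critical G \<longleftrightarrow> (\<forall>v\<in>gverts G. factorizable (delete_verts G {v}))"

definition cathedral_order :: "'a ugraph \<Rightarrow> ('a ugraph \<times> 'a ugraph) set" where
  "cathedral_order G = {(G1, G2). G1 \<in> factor_components G \<and> G2 \<in> factor_components G \<and>
    (\<exists>X. separating G X \<and> gverts G1 \<union> gverts G2 \<subseteq> X \<and>
         factor_critical (contract (induced G X) (gverts G1)))}"

definition minimum_component :: "'a ugraph \<Rightarrow> 'a ugraph \<Rightarrow> bool" where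
  "minimum_component G G0 \<longleftrightarrow> G0 \<in> factor_components G \<and>
    (\<forall>H\<in>factor_components G. (G0, H) \<in> cathedral_order G)"

definition canonical_rel :: "'a ugraph \<Rightarrow> ('a \<times> 'a) set" where
  "canonical_rel G = {(u, v). (\<exists>H\<in>factor_components G. u \<in> gverts H \<and> v \<in> gverts H) \<and>
    (u = v \<or> \<not> factorizable (delete_verts G {u, v}))}"

definition canonical_partition :: "'a ugraph \<Rightarrow> 'a set set" where
  "canonical_partition G = gverts G // canonical_rel G"

definition canonical_partition_on :: "'a ugraph \<Rightarrow> 'a ugraph \<Rightarrow> 'a set set" where
  "canonical_partition_on G H = {S \<in> canonical_partition G. S \<subseteq> gverts H}"

text \<open>Towers are indexed by the classes of the foundation's canonical partition; the values of
  \<open>T\<close> elsewhere are irrelevant.\<close>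

definition cathedral_data :: "'a ugraph \<Rightarrow> ('a set \<Rightarrow> 'a ugraph) \<Rightarrow> bool" where
  "cathedral_data G0 T \<longleftrightarrow>
    simple_graph G0 \<and> saturated G0 \<and> elementary G0 \<and>
    (\<forall>S\<in>canonical_partition G0.
      simple_graph (T S) \<and> saturated (T S) \<and> gverts (T S) \<inter> gverts G0 = {} \<and>
      (\<forall>S'\<in>canonical_partition G0. S \<noteq> S' \<longrightarrow> gverts (T S) \<inter> gverts (T S') = {}))"

definition cathedral :: "'a ugraph \<Rightarrow> ('a set \<Rightarrow> 'a ugraph) \<Rightarrow> 'a ugraph" where
  "cathedral G0 T =
    \<lparr>gverts = gverts G0 \<union> (\<Union>S\<in>canonical_partition G0. gverts (T S)),
     gedges = gedges G0 \<union> (\<Union>S\<in>canonical_partition G0. gedges (T S)) \<union>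
       {{s, t} | s t S. S \<in> canonical_partition G0 \<and> s \<in> S \<and> t \<in> gverts (T S)}\<rparr>"

definition obtained_by_cathedral ::
    "'a ugraph \<Rightarrow> 'a ugraph \<Rightarrow> ('a set \<Rightarrow> 'a ugraph) \<Rightarrow> bool" where
  "obtained_by_cathedral G G0 T \<longleftrightarrow> cathedral_data G0 T \<and> G = cathedral G0 T"

definition tower_component :: "'a ugraph \<Rightarrow> 'a ugraph \<Rightarrow> 'a set \<Rightarrow> 'a ugraph \<Rightarrow> bool" where
  "tower_component G G0 S K \<longleftrightarrow>
    K \<in> conn_components (delete_verts G (gverts G0)) \<and> neighbours G (gverts K) \<subseteq> S"

definition tower :: "'a ugraph \<Rightarrow> 'a ugraph \<Rightarrow> 'a set \<Rightarrow> 'a ugraph" where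
  "tower G G0 S =
    (if \<exists>K. tower_component G G0 S K then THE K. tower_component G G0 S K else empty_graph)"

end

theory Submission
  imports Defs
begin

text \<open>
  Write \<open>u \<sim> v\<close> if \<open>u = v\<close> or \<open>G - u - v\<close> has no perfect matching. In a saturated graph, distinct
  vertices with \<open>u \<sim> v\<close> are adjacent. From the exchange property of matchable vertex sets it follows
  that \<open>u \<sim> v \<sim> w\<close> without \<open>u \<sim> w\<close> forces the class \<open>[u] = {z. z \<sim> u}\<close> into \<open>[v]\<close>, and even the whole
  neighbourhood of \<open>u\<close>. Hence the maximal classes partition the vertex set. The vertices whose class
  is maximal induce the foundation; the other vertices of a maximal class form its tower, which has no
  neighbours outside the class and is completely joined to the foundation part of the class.
  That foundation part is a clique no two of whose vertices can be removed, so a matching sending tower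
  vertices into it can be repaired, and matchability passes between \<open>G\<close>, the foundation and the towers.
  The foundation is a single factor-connected component by a Gallai-type lemma and a parity count.
  It is the minimum, with \<open>V(G)\<close> itself as separating set: every vertex outside it has a neighbour
  in it, so after contracting the foundation the new vertex can replace any vertex in the matching.
\<close>

subsection \<open>Matchable vertex sets\<close>

text \<open>Existence of a perfect matching on \<open>X\<close>, built pair by pair so that proofs
  can use induction without naming the matching. Only edges inside \<open>X\<close> matter, so
  deleting vertices changes \<open>X\<close> and leaves \<open>E\<close> fixed.\<close>

inductive matchable :: "'a set set \<Rightarrow> 'a set \<Rightarrow> bool" for E where
  empty: "matchable E {}"
| insert: "matchable E X \<Longrightarrow> {x, y} \<in> E \<Longrightarrow> x \<noteq> y \<Longrightarrow> x \<notin> X \<Longrightarrow> y \<notin> X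
    \<Longrightarrow> matchable E (insert x (insert y X))"

lemma matchable_finite: "matchable E X \<Longrightarrow> finite X"
  by (induction rule: matchable.induct) auto

lemma matchable_even: "matchable E X \<Longrightarrow> even (card X)"
  by (induction rule: matchable.induct) (auto simp: matchable_finite)

lemma matchable_add:
  assumes "matchable E (X - {x, y})" "{x, y} \<in> E" "x \<noteq> y" "x \<in> X" "y \<in> X"
  shows "matchable E X"
proof -
  have "matchable E (insert x (insert y (X - {x, y})))"
    using assms by (intro matchable.insert) auto
  moreover have "insert x (insert y (X - {x, y})) = X" using assms by auto
  ultimately show ?thesis by simp
qed

text \<open>The order in which pairs are inserted is immaterial, so the pair containing a prescribed
  \<open>x\<close> can be taken as the last one.\<close>

lemma matchable_mate:
  assumes "matchable E X" "x \<in> X"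
  obtains y where "y \<in> X" "y \<noteq> x" "{x, y} \<in> E" "matchable E (X - {x, y})"
proof -
  have "\<exists>y\<in>X. y \<noteq> x \<and> {x, y} \<in> E \<and> matchable E (X - {x, y})"
    using assms
  proof (induction rule: matchable.induct)
    case empty then show ?case by simp
  next
    case (insert X a b)
    show ?case
    proof (cases "x = a \<or> x = b")
      case True
      have "insert a (insert b X) - {a, b} = X" using insert by auto
      then show ?thesis using True insert by (auto simp: insert_commute)
    next
      case False
      then obtain y where y: "y \<in> X" "y \<noteq> x" "{x, y} \<in> E" "matchable E (X - {x, y})"
        using insert by auto
      have "matchable E (insert a (insert b (X - {x, y})))"
        using y insert by (intro matchable.insert) auto
      moreover have "insert a (insert b X) - {x, y} = insert a (insert b (X - {x, y}))"
        using False y insert by auto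
      ultimately show ?thesis using y by (intro bexI[of _ y]) (metis, simp)
    qed
  qed
  then show ?thesis using that by blast
qed

lemma matchable_Un:
  assumes "matchable E X" "matchable E Y" "X \<inter> Y = {}"
  shows "matchable E (X \<union> Y)"
  using assms
proof (induction rule: matchable.induct)
  case empty then show ?case by simp
next
  case (insert X x y)
  then have "matchable E (insert x (insert y (X \<union> Y)))"
    by (intro matchable.insert) auto
  then show ?case by simp
qed

lemma matchable_mono: "matchable E X \<Longrightarrow> (\<And>e. e \<in> E \<Longrightarrow> e \<subseteq> X \<Longrightarrow> e \<in> E') \<Longrightarrow> matchable E' X"
proof (induction rule: matchable.induct)
  case empty show ?case by (rule matchable.empty)
next
  case (insert X x y)
  then show ?case by (intro matchable.insert) auto
qed

lemma matchable_image:
  assumes "matchable E X" "inj_on f X" "\<And>e. e \<in> E \<Longrightarrow> e \<subseteq> X \<Longrightarrow> f ` e \<in> E'"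
  shows "matchable E' (f ` X)"
  using assms
proof (induction rule: matchable.induct)
  case empty show ?case by (simp add: matchable.empty)
next
  case (insert X x y)
  have "matchable E' (f ` X)"
    by (rule insert.IH) (use insert.prems in \<open>auto simp: inj_on_def subset_insertI2\<close>)
  then have "matchable E' (insert (f x) (insert (f y) (f ` X)))"
    using insert insert.prems(2)[of "{x, y}"] by (intro matchable.insert) (auto simp: inj_on_def)
  then show ?case by simp
qed

text \<open>Symmetric exchange in the even delta-matroid of matchable sets. The element \<open>f\<close> is the other
  end of the alternating path that starts at \<open>e\<close> in the union of a perfect matching of \<open>X\<close> and one
  of \<open>Y\<close>; the induction walks along that path without mentioning it.\<close>

lemma matchable_exchange:
  assumes "matchable E X" "matchable E Y" "e \<in> X - Y"
  shows "\<exists>f. f \<in> sym_diff X Y \<and> f \<noteq> e \<and> matchable E (sym_diff X {e, f})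
    \<and> matchable E (sym_diff Y {e, f})"
  using assms
proof (induction "card X + card Y" arbitrary: X Y e rule: less_induct)
  case less
  obtain y where y: "y \<in> X" "y \<noteq> e" "{e, y} \<in> E" "matchable E (X - {e, y})"
    using matchable_mate[OF less.prems(1)] less.prems(3) by auto
  have fX: "finite X" using less.prems matchable_finite by blast
  show ?case
  proof (cases "y \<in> Y")
    case False
    have "matchable E (insert e (insert y Y))"
      using less.prems False y by (intro matchable.insert) auto
    moreover have "sym_diff Y {e, y} = insert e (insert y Y)" "sym_diff X {e, y} = X - {e, y}"
      using False less.prems y by auto
    ultimately show ?thesis using y False by (intro exI[of _ y]) auto
  next
    case True
    have "card (X - {e, y}) < card X"
      by (rule psubset_card_mono[OF fX]) (use y in auto)
    \<comment> \<open>The partner \<open>y\<close> of \<open>e\<close> also lies in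
      \<open>Y\<close>, so the alternating walk goes on from \<open>y\<close> with the roles of the
      two sets exchanged.\<close>
    then obtain f where f: "f \<in> sym_diff Y (X - {e, y})" "f \<noteq> y"
      "matchable E (sym_diff Y {y, f})" "matchable E (sym_diff (X - {e, y}) {y, f})"
      using less.hyps[of Y "X - {e, y}" y] less.prems(2) y True by auto
    have fe: "f \<noteq> e" using f less.prems by auto
    have "matchable E (insert e (insert y (sym_diff Y {y, f})))"
      using f y True fe less.prems by (intro matchable.insert) auto
    moreover have "insert e (insert y (sym_diff Y {y, f})) = sym_diff Y {e, f}"
      using f y True fe less.prems by auto
    moreover have "sym_diff (X - {e, y}) {y, f} = sym_diff X {e, f}"
      using f y True fe less.prems by auto
    ultimately show ?thesis using f fe y by (intro exI[of _ f]) auto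
  qed
qed

text \<open>Complementation in \<open>V\<close> preserves symmetric differences, so exchange can be
  read on the deleted sets instead.\<close>

lemma matchable_exchange_compl:
  assumes "matchable E (V - Z)" "matchable E (V - Z')" "Z \<subseteq> V" "Z' \<subseteq> V" "e \<in> Z' - Z"
  shows "\<exists>f. f \<in> sym_diff Z Z' \<and> f \<noteq> e \<and> matchable E (V - sym_diff Z {e, f})
    \<and> matchable E (V - sym_diff Z' {e, f})"
proof -
  have e: "e \<in> (V - Z) - (V - Z')" using assms by auto
  obtain f where f: "f \<in> sym_diff (V - Z) (V - Z')" "f \<noteq> e"
    "matchable E (sym_diff (V - Z) {e, f})" "matchable E (sym_diff (V - Z') {e, f})"
    using matchable_exchange[OF assms(1,2) e] by blast
  have "sym_diff (V - Z) {e, f} = V - sym_diff Z {e, f}"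
    "sym_diff (V - Z') {e, f} = V - sym_diff Z' {e, f}"
    using f assms by auto
  moreover have "f \<in> sym_diff Z Z'" using f by auto
  ultimately show ?thesis using f by metis
qed

section \<open>Matchings relative to a vertex subset\<close>

text \<open>An edge lies in some perfect matching of \<open>X\<close> exactly when removing its ends
  leaves a matchable set. The hypothesis thus keeps every perfect matching of \<open>X\<close> from
  using an edge that leaves \<open>T\<close>, so \<open>T\<close> is matched within itself.\<close>

lemma matchable_restrict:
  assumes "matchable E X" "T \<subseteq> X"
    and "\<And>t y. t \<in> T \<Longrightarrow> y \<in> X - T \<Longrightarrow> {t, y} \<in> E \<Longrightarrow> \<not> matchable E (X - {t, y})"
  shows "matchable E T"
  using assms
proof (induction "card T" arbitrary: X T rule: less_induct)
  case less
  show ?case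
  proof (cases "T = {}")
    case True then show ?thesis by (simp add: matchable.empty)
  next
    case False
    then obtain t where t: "t \<in> T" by auto
    obtain y where y: "y \<in> X" "y \<noteq> t" "{t, y} \<in> E" "matchable E (X - {t, y})"
      using matchable_mate[OF less.prems(1)] t less.prems(2) by auto
    have yT: "y \<in> T" using less.prems(3)[of t y] y t by auto
    have "finite T" using less.prems matchable_finite finite_subset by blast
    then have "card (T - {t, y}) < card T"
      by (rule psubset_card_mono) (use t in auto)
    then have "matchable E (T - {t, y})"
    proof (rule less.hyps[OF _ y(4)])
      show "T - {t, y} \<subseteq> X - {t, y}" using less.prems by auto
      fix t' y' assume *: "t' \<in> T - {t, y}" "y' \<in> X - {t, y} - (T - {t, y})" "{t', y'} \<in> E"
      show "\<not> matchable E (X - {t, y} - {t', y'})"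
      proof
        assume "matchable E (X - {t, y} - {t', y'})"
        moreover have "X - {t, y} - {t', y'} = X - {t', y'} - {t, y}" by auto
        ultimately have "matchable E (X - {t', y'})"
          using y t * less.prems by - (rule matchable_add[of E _ t y], auto)
        then show False using less.prems(3)[of t' y'] * by auto
      qed
    qed
    then show ?thesis using y t yT by - (rule matchable_add[of E _ t y], auto)
  qed
qed

text \<open>\<open>Z\<close> collects the partners outside \<open>T\<close> of the vertices of \<open>T\<close> in a perfect matching of \<open>X\<close>.\<close>

lemma matchable_split:
  assumes "matchable E X" "T \<subseteq> X"
    and "\<And>t y. t \<in> T \<Longrightarrow> y \<in> X - T \<Longrightarrow> {t, y} \<in> E \<Longrightarrow> y \<in> Q"
  shows "\<exists>Z. Z \<subseteq> Q \<inter> (X - T) \<and> matchable E (X - T - Z) \<and> even (card Z + card T)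
    \<and> (Z = {} \<longrightarrow> matchable E T)"
  using assms
proof (induction "card T" arbitrary: X T rule: less_induct)
  case less
  have fin: "finite T" "finite X" using less.prems matchable_finite finite_subset by blast+
  show ?case
  proof (cases "T = {}")
    case True then show ?thesis using less.prems by (intro exI[of _ "{}"]) (auto simp: matchable.empty)
  next
    case False
    then obtain t where t: "t \<in> T" by auto
    obtain y where y: "y \<in> X" "y \<noteq> t" "{t, y} \<in> E" "matchable E (X - {t, y})"
      using matchable_mate[OF less.prems(1)] t less.prems(2) by auto
    have lt: "card (T - {t, y}) < card T"
      by (rule psubset_card_mono[OF fin(1)]) (use t in auto)
    have eq: "X - {t, y} - (T - {t, y}) = X - T - {y}" using t by auto
    obtain Z where Z: "Z \<subseteq> Q \<inter> (X - T - {y})" "matchable E (X - T - {y} - Z)"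
      "even (card Z + card (T - {t, y}))" "Z = {} \<longrightarrow> matchable E (T - {t, y})"
      using less.hyps[OF lt y(4)] less.prems(2,3) unfolding eq by blast
    have fZ: "finite Z" using Z fin by (meson finite_Diff finite_Int finite_subset)
    show ?thesis
    proof (cases "y \<in> T")
      case True
      have "card T = card (T - {t, y}) + 2"
        using card_Diff_subset[of "{t, y}" T] True t y(2) fin card_mono[of T "{t, y}"] by auto
      moreover have "X - T - {y} = X - T" using True by auto
      moreover have "matchable E (T - {t, y}) \<Longrightarrow> matchable E T"
        using y t True by - (rule matchable_add[of E _ t y], auto)
      ultimately show ?thesis using Z by (intro exI[of _ Z]) auto
    next
      case False
      have "T - {t, y} = T - {t}" using False by auto
      then have "card T = card (T - {t, y}) + 1"
        using t fin by (metis Suc_eq_plus1 card_Suc_Diff1)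
      moreover have "card (insert y Z) = card Z + 1"
      proof -
        have "y \<notin> Z" using Z(1) by blast
        then show ?thesis using fZ by simp
      qed
      moreover have "X - T - insert y Z = X - T - {y} - Z" by auto
      moreover have "y \<in> Q" using less.prems(3)[of t y] t y False by auto
      ultimately show ?thesis using Z y False by (intro exI[of _ "insert y Z"]) auto
    qed
  qed
qed

text \<open>An even clique can be paired off arbitrarily.\<close>

lemma matchable_add_clique:
  assumes "matchable E (X - Z)" "Z \<subseteq> X" "finite Z" "even (card Z)"
    and "\<And>x y. x \<in> Z \<Longrightarrow> y \<in> Z \<Longrightarrow> x \<noteq> y \<Longrightarrow> {x, y} \<in> E"
  shows "matchable E X"
proof -
  have "matchable E Z" using assms(3-5)
  proof (induction "card Z" arbitrary: Z rule: less_induct)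
    case less
    show ?case
    proof (cases "Z = {}")
      case True then show ?thesis by (simp add: matchable.empty)
    next
      case False
      then obtain x where x: "x \<in> Z" by auto
      have "Z \<noteq> {x}" using less.prems by auto
      then obtain y where y: "y \<in> Z" "y \<noteq> x" using x by auto
      have c: "card Z = card (Z - {x, y}) + 2"
        using card_Diff_subset[of "{x, y}" Z] x y less.prems(1) card_mono[of Z "{x, y}"] by auto
      have "matchable E (Z - {x, y})"
        by (rule less.hyps) (use c less.prems in auto)
      then show ?thesis using x y less.prems by - (rule matchable_add[of E _ x y], auto)
    qed
  qed
  then have "matchable E ((X - Z) \<union> Z)" using assms by (intro matchable_Un) auto
  moreover have "(X - Z) \<union> Z = X" using assms by auto
  ultimately show ?thesis by simp
qed

subsection \<open>Saturated graphs and maximal classes\<close>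

text \<open>Exchange between \<open>V\<close> and \<open>V - Z\<close> would turn any vertex of a
  nonempty \<open>Z\<close> into one half of a removable pair inside \<open>Z\<close>.\<close>

lemma matchable_barrier:
  assumes "matchable E V" "matchable E (V - Z)" "Z \<subseteq> V"
    and "\<And>x y. x \<in> Z \<Longrightarrow> y \<in> Z \<Longrightarrow> x \<noteq> y \<Longrightarrow> \<not> matchable E (V - {x, y})"
  shows "Z = {}"
proof (rule ccontr)
  assume "Z \<noteq> {}"
  then obtain e where e: "e \<in> Z" by auto
  then obtain f where "f \<in> Z" "f \<noteq> e" "matchable E (V - {e, f})"
    using matchable_exchange_compl[of E V "{}" Z e] assms by auto
  then show False using assms(4) e by metis
qed

text \<open>Saturation without counting: a missing edge \<open>xy\<close> creates a new perfect
  matching iff the rest without \<open>x\<close> and \<open>y\<close> is matchable. Since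
  \<open>V\<close> is separate from \<open>E\<close>, one edge set serves the graph, its base and
  its towers.\<close>

locale saturated_pair =
  fixes E :: "'a set set" and V :: "'a set"
  assumes matchable_verts: "matchable E V"
    and saturated: "x \<in> V \<Longrightarrow> y \<in> V \<Longrightarrow> x \<noteq> y \<Longrightarrow> {x, y} \<notin> E \<Longrightarrow> matchable E (V - {x, y})"
begin

text \<open>Unlike \<open>canonical_rel\<close>, this makes no reference to factor-connected
  components. The relation is reflexive on \<open>V\<close> and symmetric, but in general not
  transitive.\<close>

definition cls :: "'a \<Rightarrow> 'a set" where
  "cls v = {u \<in> V. u = v \<or> \<not> matchable E (V - {u, v})}"

lemma finite_verts: "finite V"
  using matchable_verts by (rule matchable_finite)

lemma cls_subset: "cls v \<subseteq> V"
  by (auto simp: cls_def)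

lemma cls_refl: "v \<in> V \<Longrightarrow> v \<in> cls v"
  by (simp add: cls_def)

lemma cls_sym: "u \<in> cls v \<Longrightarrow> v \<in> V \<Longrightarrow> v \<in> cls u"
  by (auto simp: cls_def insert_commute)

lemma cls_not_matchable: "u \<in> cls v \<Longrightarrow> u \<noteq> v \<Longrightarrow> \<not> matchable E (V - {u, v})"
  by (simp add: cls_def)

lemma not_cls_matchable: "u \<in> V \<Longrightarrow> u \<notin> cls v \<Longrightarrow> u \<noteq> v \<and> matchable E (V - {u, v})"
  by (simp add: cls_def)

lemma cls_edge: "u \<in> cls v \<Longrightarrow> v \<in> V \<Longrightarrow> u \<noteq> v \<Longrightarrow> {u, v} \<in> E"
  using saturated by (auto simp: cls_def)

text \<open>If no edge left \<open>A\<close>, then \<open>A\<close> would be even; but saturation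
  would make a nonadjacent pair \<open>a\<close>, \<open>b\<close> across the cut removable, so that
  \<open>A - {a}\<close> would be even too.\<close>

lemma connected_verts:
  assumes "A \<subseteq> V" "A \<noteq> {}" "A \<noteq> V"
  shows "\<exists>a\<in>A. \<exists>b\<in>V - A. {a, b} \<in> E"
proof (rule ccontr)
  assume no: "\<not> ?thesis"
  then have "matchable E A" using matchable_restrict[OF matchable_verts assms(1)] by blast
  then have ev: "even (card A)" by (rule matchable_even)
  obtain a b where ab: "a \<in> A" "b \<in> V - A" using assms by auto
  then have m: "matchable E (V - {a, b})" using saturated[of a b] no assms(1) by auto
  have "\<exists>Z. Z \<subseteq> {} \<inter> (V - {a, b} - (A - {a})) \<and> matchable E (V - {a, b} - (A - {a}) - Z)
      \<and> even (card Z + card (A - {a})) \<and> (Z = {} \<longrightarrow> matchable E (A - {a}))"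
    by (rule matchable_split[OF m]) (use no ab assms in auto)
  then obtain Z :: "'a set" where "Z \<subseteq> {}" "even (card Z + card (A - {a}))" by blast
  then have "even (card (A - {a}))" by simp
  moreover have "card A = Suc (card (A - {a}))"
    using card.remove[OF finite_subset[OF assms(1) finite_verts] ab(1)] .
  ultimately show False using ev by simp
qed

text \<open>Exchanging between \<open>V - {u, w}\<close> and \<open>V - {v, z}\<close>, the only outcome compatible with
  \<open>u, w \<in> cls v\<close> makes \<open>V - {u, w, v, z}\<close> matchable, and the edge \<open>u z\<close> then gives
  a perfect matching of \<open>V - {w, v}\<close>.\<close>

lemma cls_absorbs_neighbour:
  assumes v: "v \<in> V" and u: "u \<in> cls v" and w: "w \<in> cls v" and "u \<noteq> w"
    and m: "matchable E (V - {u, w})" and z: "z \<in> V" "{u, z} \<in> E"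
  shows "z \<in> cls v"
proof (rule ccontr)
  assume nz: "z \<notin> cls v"
  then have zv: "z \<noteq> v" "matchable E (V - {v, z})"
    using not_cls_matchable[OF z(1)] by (auto simp: insert_commute)
  have uv: "u \<noteq> v" using cls_not_matchable[OF w] m \<open>u \<noteq> w\<close> by (auto simp: insert_commute)
  have wv: "w \<noteq> v" using cls_not_matchable[OF u] m \<open>u \<noteq> w\<close> by auto
  have inV: "u \<in> V" "w \<in> V" using u w cls_subset by auto
  have zu: "z \<noteq> u" "z \<noteq> w" using nz u w by auto
  obtain f where f: "f \<in> sym_diff {u, w} {v, z}" "f \<noteq> v"
    "matchable E (V - sym_diff {u, w} {v, f})"
    using matchable_exchange_compl[OF m zv(2), of v] inV v z uv wv by auto
  have nu: "\<not> matchable E (V - {u, v})" and nw: "\<not> matchable E (V - {w, v})"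
    using cls_not_matchable u w uv wv by auto
  consider "f = u" | "f = w" | "f = z" using f by auto
  then show False
  proof cases
    case 1
    then have "sym_diff {u, w} {v, f} = {w, v}" using uv wv \<open>u \<noteq> w\<close> by auto
    then show False using f(3) nw by simp
  next
    case 2
    then have "sym_diff {u, w} {v, f} = {u, v}" using uv wv \<open>u \<noteq> w\<close> by auto
    then show False using f(3) nu by simp
  next
    case 3
    then have "V - sym_diff {u, w} {v, f} = V - {w, v} - {u, z}" using uv wv zu by auto
    then have "matchable E (V - {w, v})"
      using f(3) z zu zv(1) uv \<open>u \<noteq> w\<close> inV by - (rule matchable_add[of E _ u z], auto)
    then show False using nw by simp
  qed
qed

text \<open>By saturation the other members of \<open>cls u\<close> are neighbours of
  \<open>u\<close>, and those are absorbed by \<open>cls v\<close>.\<close>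

lemma cls_subset_cls:
  assumes "v \<in> V" "u \<in> cls v" "w \<in> cls v" "u \<noteq> w" "matchable E (V - {u, w})"
  shows "cls u \<subseteq> cls v"
proof
  fix z assume z: "z \<in> cls u"
  have uV: "u \<in> V" using assms cls_subset by auto
  show "z \<in> cls v"
  proof (cases "z = u")
    case True then show ?thesis using assms by simp
  next
    case False
    then have "{u, z} \<in> E" using cls_edge[OF z uV] by (simp add: insert_commute)
    then show ?thesis using cls_absorbs_neighbour[OF assms] z cls_subset by auto
  qed
qed

text \<open>In a cathedral, a vertex \<open>s\<close> of the foundation lying in the block \<open>S\<close> has
  \<open>cls s = S \<union> V(G\<^sub>S)\<close>, whereas \<open>cls t\<close> is strictly smaller than that for \<open>t\<close> in the tower. So the
  foundation is recovered from maximality.\<close>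

definition base :: "'a set" where
  "base = {v \<in> V. \<forall>w\<in>V. cls v \<subseteq> cls w \<longrightarrow> cls w = cls v}"

lemma base_subset: "base \<subseteq> V"
  by (auto simp: base_def)

section \<open>Partition of the vertices into maximal classes\<close>

text \<open>Either some \<open>w\<close> in \<open>cls u\<close> is unrelated to \<open>z\<close>,
  and this failure of transitivity forces the inclusion, or \<open>cls u\<close> lies in
  \<open>cls z\<close> and maximality gives equality.\<close>

lemma cls_base_subset:
  assumes u: "u \<in> base" and z: "z \<in> cls u"
  shows "cls z \<subseteq> cls u"
proof (rule ccontr)
  assume n: "\<not> cls z \<subseteq> cls u"
  have V: "u \<in> V" "z \<in> V" using u z base_subset cls_subset by auto
  have "cls u \<subseteq> cls z"
  proof (rule ccontr)
    assume "\<not> cls u \<subseteq> cls z"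
    then obtain w where w: "w \<in> cls u" "w \<notin> cls z" by auto
    then have "w \<noteq> z" "matchable E (V - {z, w})"
      using not_cls_matchable[of w z] cls_subset by (auto simp: insert_commute)
    then have "cls z \<subseteq> cls u" using cls_subset_cls[OF V(1) z w(1)] by auto
    then show False using n by simp
  qed
  then have "cls z = cls u" using u V by (auto simp: base_def)
  then show False using n by simp
qed

text \<open>A common vertex \<open>z\<close> carries \<open>a\<close> into \<open>cls b\<close>: by
  symmetry \<open>a\<close> is in \<open>cls z\<close>, which lies in \<open>cls b\<close>. The same
  argument with \<open>a\<close> and \<open>b\<close> exchanged gives equality.\<close>

lemma cls_base_eq:
  assumes "u \<in> base" "v \<in> base" "z \<in> cls u" "z \<in> cls v"
  shows "cls u = cls v"
proof -
  have "a \<in> base \<Longrightarrow> b \<in> base \<Longrightarrow> z \<in> cls a \<Longrightarrow> z \<in> cls b \<Longrightarrow> cls a \<subseteq> cls b" for a b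
    using cls_base_subset cls_sym base_subset by (meson subsetD subset_trans)
  then show ?thesis using assms by blast
qed

lemma cls_base_cover:
  assumes "z \<in> V"
  obtains u where "u \<in> base" "z \<in> cls u"
proof -
  \<comment> \<open>A class of largest size above \<open>cls z\<close> is maximal under inclusion
    because \<open>V\<close> is finite; \<open>Suc (card V)\<close> is the strict bound on
    sizes.\<close>
  have "\<exists>u. (u \<in> V \<and> cls z \<subseteq> cls u) \<and> (\<forall>w. w \<in> V \<and> cls z \<subseteq> cls w \<longrightarrow> card (cls w) \<le> card (cls u))"
    by (rule ex_has_greatest_nat[of _ z _ "Suc (card V)"])
      (use assms in \<open>auto intro!: le_imp_less_Suc card_mono[OF finite_verts cls_subset]\<close>)
  then obtain u where u: "u \<in> V" "cls z \<subseteq> cls u"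
    "\<And>w. w \<in> V \<Longrightarrow> cls z \<subseteq> cls w \<Longrightarrow> card (cls w) \<le> card (cls u)" by blast
  have "cls w = cls u" if "w \<in> V" "cls u \<subseteq> cls w" for w
    using card_seteq[OF finite_subset[OF cls_subset finite_verts] that(2)] u that by auto
  then have "u \<in> base" using u by (auto simp: base_def)
  then show ?thesis using that u cls_refl[OF assms] by auto
qed

lemma base_mem_cls_eq: "u \<in> base \<Longrightarrow> s \<in> cls u \<Longrightarrow> s \<in> base \<Longrightarrow> cls s = cls u"
  using cls_base_eq[of s u s] cls_refl base_subset by auto

lemma base_nonempty: "V \<noteq> {} \<Longrightarrow> base \<noteq> {}"
  using cls_base_cover by blast

section \<open>Edges at tower vertices\<close>

text \<open>Since \<open>t\<close> is outside \<open>base\<close>, \<open>cls t\<close> is a proper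
  subset of \<open>cls u\<close>. Any \<open>w\<close> in the difference gives a failure of
  transitivity through \<open>u\<close>, and then \<open>cls u\<close> absorbs all neighbours of
  \<open>t\<close>.\<close>

lemma tower_neighbour:
  assumes u: "u \<in> base" and t: "t \<in> cls u - base" and y: "y \<in> V" "{t, y} \<in> E"
  shows "y \<in> cls u"
proof -
  have V: "u \<in> V" "t \<in> V" using u t base_subset cls_subset by auto
  have sub: "cls t \<subseteq> cls u" using cls_base_subset u t by auto
  have "cls t \<noteq> cls u" using u t V by (auto simp: base_def)
  then obtain w where w: "w \<in> cls u" "w \<notin> cls t" using sub by auto
  then have "w \<noteq> t" "matchable E (V - {t, w})"
    using not_cls_matchable[of w t] cls_subset by (auto simp: insert_commute)
  then show ?thesis using cls_absorbs_neighbour[of u t w y] w t y V by auto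
qed

text \<open>Such an edge stays inside one maximal class, which is the class of its base end
  \<open>y\<close>; hence its ends are related.\<close>

lemma tower_base_edge_not_allowed:
  assumes t: "t \<in> V - base" and y: "y \<in> base" "{t, y} \<in> E"
  shows "\<not> matchable E (V - {t, y})"
proof -
  obtain u where u: "u \<in> base" "t \<in> cls u" using t cls_base_cover by auto
  have "y \<in> cls u" using tower_neighbour[of u t y] u t y base_subset by auto
  then have "cls y = cls u" using base_mem_cls_eq[OF u(1) _ y(1)] by simp
  then have "t \<in> cls y" using u by simp
  then show ?thesis using cls_not_matchable t y by auto
qed

section \<open>Matchability passed between the graph, its base and its towers\<close>

text \<open>Edges leaving \<open>K\<close> can only go to \<open>base\<close>, and no perfect
  matching of \<open>V\<close> uses such an edge.\<close>

lemma matchable_closed: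
  assumes "K \<subseteq> V - base" "\<And>t y. t \<in> K \<Longrightarrow> y \<in> V - base - K \<Longrightarrow> {t, y} \<notin> E"
  shows "matchable E K"
proof (rule matchable_restrict[OF matchable_verts])
  show "K \<subseteq> V" using assms by auto
  fix t y assume *: "t \<in> K" "y \<in> V - K" "{t, y} \<in> E"
  then have "y \<in> base" using assms by auto
  then show "\<not> matchable E (V - {t, y})" using tower_base_edge_not_allowed * assms by auto
qed

lemma matchable_base: "matchable E base"
proof (rule matchable_restrict[OF matchable_verts base_subset])
  fix t y assume "t \<in> base" "y \<in> V - base" "{t, y} \<in> E"
  then show "\<not> matchable E (V - {t, y})"
    using tower_base_edge_not_allowed[of y t] by (simp add: insert_commute)
qed

lemma matchable_compl_base: "matchable E (V - base)"
  by (rule matchable_closed) auto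

lemma matchable_tower: "u \<in> base \<Longrightarrow> matchable E (cls u - base)"
  by (rule matchable_closed) (use tower_neighbour cls_subset in blast)+

text \<open>Because \<open>s\<close> is in \<open>base\<close>, \<open>cls s = cls u\<close>, so
  every other vertex of the class is related to \<open>s\<close>. This yields the complete join
  between a tower and its block.\<close>

lemma class_base_edge:
  assumes "u \<in> base" "k \<in> cls u" "s \<in> cls u" "s \<in> base" "k \<noteq> s"
  shows "{k, s} \<in> E" "\<not> matchable E (V - {k, s})"
  using base_mem_cls_eq[of u s] cls_edge[of k s] cls_not_matchable[of k s] assms base_subset by auto

lemma class_base_barrier:
  assumes "u \<in> base" "Z \<subseteq> cls u \<inter> base" "matchable E (V - Z)"
  shows "Z = {}"
proof (rule matchable_barrier[OF matchable_verts assms(3)])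
  show "Z \<subseteq> V" using assms base_subset by auto
  fix x y assume "x \<in> Z" "y \<in> Z" "x \<noteq> y"
  then show "\<not> matchable E (V - {x, y})"
    using class_base_edge(2)[OF assms(1), of x y] assms(2) by auto
qed

text \<open>Each tower is even and its outside neighbours form a clique, so the base vertices that a
  matching sends into the tower can be matched with each other instead.\<close>

lemma matchable_base_minus_two:
  assumes ab: "a \<in> base" "b \<in> base" "a \<noteq> b"
  shows "matchable E (base - {a, b}) \<longleftrightarrow> matchable E (V - {a, b})"
proof
  assume "matchable E (base - {a, b})"
  then have "matchable E ((base - {a, b}) \<union> (V - base))"
    using matchable_compl_base by (rule matchable_Un) auto
  moreover have "(base - {a, b}) \<union> (V - base) = V - {a, b}" using ab base_subset by auto
  ultimately show "matchable E (V - {a, b})" by simp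
next
  assume m: "matchable E (V - {a, b})"
  have fin: "finite base" using finite_subset[OF base_subset finite_verts] .
  \<comment> \<open>The towers are stripped off one at a time. Several vertices of \<open>J\<close>
    may share a class, so the tower of \<open>u\<close> may already be gone.\<close>
  have "matchable E (V - {a, b} - (\<Union>u\<in>J. cls u - base))" if "finite J" "J \<subseteq> base" for J
    using that
  proof (induction J rule: finite_induct)
    case empty then show ?case using m by simp
  next
    case (insert u J)
    let ?X = "V - {a, b} - (\<Union>u\<in>J. cls u - base)"
    let ?T = "cls u - base"
    have ub: "u \<in> base" using insert by simp
    have m': "matchable E ?X" using insert by simp
    have eq: "V - {a, b} - (\<Union>u\<in>insert u J. cls u - base) = ?X - ?T" by auto
    show ?case
    proof (cases "\<exists>u'\<in>J. cls u = cls u'")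
      case True
      then have "?X - ?T = ?X" by auto
      then show ?thesis using m' eq by simp
    next
      case False
      have "cls u \<inter> cls u' = {}" if "u' \<in> J" for u'
        using cls_base_eq[of u u'] that False insert.prems ub by blast
      then have sub: "?T \<subseteq> ?X" using cls_subset ab by fastforce
      have "\<exists>Z. Z \<subseteq> (cls u \<inter> base) \<inter> (?X - ?T) \<and> matchable E (?X - ?T - Z)
        \<and> even (card Z + card ?T) \<and> (Z = {} \<longrightarrow> matchable E ?T)"
        by (rule matchable_split[OF m' sub]) (use tower_neighbour[OF ub] in blast)
      then obtain Z where Z: "Z \<subseteq> cls u \<inter> base" "Z \<subseteq> ?X - ?T" "matchable E (?X - ?T - Z)"
        "even (card Z + card ?T)" by blast
      have "even (card Z)" using Z(4) matchable_even[OF matchable_tower[OF ub]] by simp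
      moreover have "finite Z" using Z(1) fin finite_subset by blast
      moreover have "{p, q} \<in> E" if "p \<in> Z" "q \<in> Z" "p \<noteq> q" for p q
        using class_base_edge(1)[OF ub, of p q] Z(1) that by auto
      ultimately have "matchable E (?X - ?T)"
        using matchable_add_clique[OF Z(3,2)] by blast
      then show ?thesis using eq by simp
    qed
  qed
  from this[of base] fin have "matchable E (V - {a, b} - (\<Union>u\<in>base. cls u - base))" by simp
  moreover have "V - {a, b} - (\<Union>u\<in>base. cls u - base) = base - {a, b}"
    using cls_base_cover base_subset by blast
  ultimately show "matchable E (base - {a, b})" by simp
qed

text \<open>Let \<open>Z\<close> be the base partners of the remaining tower vertices. Replacing
  their matching edges by a perfect matching of the full tower shows that \<open>V - Z\<close> is
  matchable, so the barrier property empties \<open>Z\<close>.\<close>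

lemma tower_split:
  assumes u: "u \<in> base" and xy: "x \<in> cls u - base" "y \<in> cls u - base"
    and m: "matchable E (V - {x, y})"
  shows "matchable E (cls u - base - {x, y})"
proof -
  let ?T = "cls u - base - {x, y}"
  have "\<exists>Z. Z \<subseteq> (cls u \<inter> base) \<inter> (V - {x, y} - ?T) \<and> matchable E (V - {x, y} - ?T - Z)
    \<and> even (card Z + card ?T) \<and> (Z = {} \<longrightarrow> matchable E ?T)"
    by (rule matchable_split[OF m]) (use tower_neighbour[OF u] cls_subset in blast)+
  then obtain Z where Z: "Z \<subseteq> cls u \<inter> base" "matchable E (V - {x, y} - ?T - Z)"
    "Z = {} \<longrightarrow> matchable E ?T" by blast
  have "V - {x, y} - ?T - Z = V - Z - (cls u - base)" using xy Z(1) by auto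
  then have "matchable E ((V - Z - (cls u - base)) \<union> (cls u - base))"
    using Z(2) matchable_tower[OF u] by (intro matchable_Un) auto
  moreover have "(V - Z - (cls u - base)) \<union> (cls u - base) = V - Z"
    using Z(1) cls_subset by auto
  ultimately show ?thesis using Z(3) class_base_barrier[OF u Z(1)] by simp
qed

text \<open>The parity argument for connectedness, run inside the tower: a closed proper part
  \<open>K\<close> would be even, and so would \<open>K - {x}\<close> after removing a nonadjacent
  pair across the cut.\<close>

lemma tower_connected:
  assumes u: "u \<in> base" and K: "K \<subseteq> cls u - base" "K \<noteq> {}"
    and closed: "\<And>x y. x \<in> K \<Longrightarrow> y \<in> cls u - base - K \<Longrightarrow> {x, y} \<notin> E"
  shows "K = cls u - base"
proof (rule ccontr)
  assume "K \<noteq> cls u - base"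
  then obtain x y where xy: "x \<in> K" "y \<in> cls u - base - K" using K by auto
  have V: "x \<in> V" "y \<in> V" "x \<noteq> y" using xy K cls_subset by auto
  have m: "matchable E (V - {x, y})" using saturated[OF V] closed[OF xy] by simp
  have m': "matchable E (cls u - base - {x, y})"
    by (rule tower_split[OF u _ _ m]) (use xy K in auto)
  have "K - {x} \<subseteq> cls u - base - {x, y}" using K xy by auto
  then have "matchable E (K - {x})"
    by (rule matchable_restrict[OF m']) (use closed xy in blast)
  moreover have "matchable E K"
    by (rule matchable_restrict[OF matchable_tower[OF u] K(1)]) (use closed in blast)
  moreover have "card K = Suc (card (K - {x}))"
    using card.remove[OF matchable_finite xy(1)] calculation by blast
  ultimately show False using matchable_even[of E K] matchable_even[of E "K - {x}"] by simp
qed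

lemma saturated_pair_base: "saturated_pair E base"
proof
  show "matchable E base" by (rule matchable_base)
  fix x y assume "x \<in> base" "y \<in> base" "x \<noteq> y" "{x, y} \<notin> E"
  then show "matchable E (base - {x, y})"
    using saturated[of x y] matchable_base_minus_two[of x y] base_subset by auto
qed

lemma cls_base: "v \<in> base \<Longrightarrow> saturated_pair.cls E base v = cls v \<inter> base"
  using saturated_pair.cls_def[OF saturated_pair_base] matchable_base_minus_two base_subset
  by (auto simp: cls_def)

end

subsection \<open>Connectedness by allowed edges\<close>

text \<open>The transitive case. It covers the base, and it will imply connectedness by allowed
  edges.\<close>

locale saturated_equiv = saturated_pair +
  assumes cls_eq: "v \<in> V \<Longrightarrow> u \<in> cls v \<Longrightarrow> cls u = cls v"
begin

definition link :: "'a set \<Rightarrow> ('a \<times> 'a) set" where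
  "link W = {(p, q). p \<in> W \<and> q \<in> W \<and> {p, q} \<in> E}"

lemma link_sym: "sym (link W)"
  by (auto simp: sym_def link_def insert_commute)

lemma cls_pair_not_matchable:
  "s \<in> V \<Longrightarrow> p \<in> cls s \<Longrightarrow> q \<in> cls s \<Longrightarrow> p \<noteq> q \<Longrightarrow> \<not> matchable E (V - {p, q})"
  using cls_eq[of s q] cls_not_matchable[of p q] by auto

text \<open>Exchange with \<open>V\<close> at \<open>d\<close> puts back \<open>d\<close> together
  with one of \<open>p\<close>, \<open>q\<close>, \<open>r\<close>; the other two would be a
  removable pair within one class.\<close>

lemma cls_triple_barrier:
  assumes s: "s \<in> V" and p: "{p, q, r} \<subseteq> cls s" "p \<noteq> q" "p \<noteq> r" "q \<noteq> r"
    and d: "d \<in> V - cls s"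
  shows "\<not> matchable E (V - {p, d, q, r})"
proof
  assume m: "matchable E (V - {p, d, q, r})"
  have m0: "matchable E (V - {})" using matchable_verts by simp
  have sub: "{p, d, q, r} \<subseteq> V" using p d cls_subset by auto
  obtain f where f: "f \<in> sym_diff {} {p, d, q, r}" "f \<noteq> d"
    "matchable E (V - sym_diff {p, d, q, r} {d, f})"
    using matchable_exchange_compl[OF m0 m empty_subsetI sub, of d] by blast
  have n: "d \<noteq> p" "d \<noteq> q" "d \<noteq> r" using d p by auto
  consider "f = p" | "f = q" | "f = r" using f by auto
  then show False
  proof cases
    case 1
    then have "sym_diff {p, d, q, r} {d, f} = {q, r}" using n p by auto
    then show False using f(3) cls_pair_not_matchable[OF s, of q r] p by simp
  next
    case 2
    then have "sym_diff {p, d, q, r} {d, f} = {p, r}" using n p by auto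
    then show False using f(3) cls_pair_not_matchable[OF s, of p r] p by simp
  next
    case 3
    then have "sym_diff {p, d, q, r} {d, f} = {p, q}" using n p by auto
    then show False using f(3) cls_pair_not_matchable[OF s, of p q] p by simp
  qed
qed

text \<open>A variant of Gallai's lemma: being equal or not removable together with \<open>p, q\<close> is a transitive
  relation on the complement of \<open>cls s\<close>, by exchange, and it contains adjacency.\<close>

lemma component_barrier:
  assumes s: "s \<in> V" and p: "p \<in> cls s" "q \<in> cls s" "p \<noteq> q" and d: "d \<in> V - cls s"
    and path: "(d, d') \<in> (link (V - cls s))\<^sup>*"
  shows "d = d' \<or> \<not> matchable E (V - {p, q, d, d'})"
  using path
proof (induction rule: rtrancl_induct)
  case base then show ?case by simp
next
  case (step y z)
  have yz: "y \<in> V - cls s" "z \<in> V - cls s" "{y, z} \<in> E" using step by (auto simp: link_def)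
  have pq: "p \<in> V" "q \<in> V" "\<not> matchable E (V - {p, q})"
    using p cls_subset cls_pair_not_matchable[OF s] by auto
  have ne: "y \<noteq> p" "y \<noteq> q" "z \<noteq> p" "z \<noteq> q" "d \<noteq> p" "d \<noteq> q" using yz p d by auto
  have nyz: "\<not> matchable E (V - {p, q, y, z})" if "y \<noteq> z"
  proof
    assume "matchable E (V - {p, q, y, z})"
    moreover have "V - {p, q, y, z} = V - {p, q} - {y, z}" by auto
    ultimately have "matchable E (V - {p, q})"
      using yz ne that by - (rule matchable_add[of E _ y z], auto)
    then show False using pq by simp
  qed
  show ?case
  proof (rule ccontr)
    assume "\<not> ?case"
    then have dz: "d \<noteq> z" and m: "matchable E (V - {p, q, d, z})" by auto
    show False
    proof (cases "d = y \<or> y = z")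
      case True
      then show False using step.IH nyz dz m by auto
    next
      case False
      \<comment> \<open>Exchange at \<open>y\<close> between the deleted sets
        \<open>{p, q, d, z}\<close> and \<open>{p, y}\<close>. The partners \<open>q\<close>,
        \<open>d\<close>, \<open>z\<close> would make \<open>{p, q}\<close>,
        \<open>{p, q, y, z}\<close> or \<open>{p, q, d, y}\<close> removable, and each of these is
        excluded.\<close>
      have "y \<notin> cls p" using cls_eq[OF s p(1)] yz by simp
      then have "matchable E (V - {p, y})"
        using not_cls_matchable[of y p] yz by (auto simp: insert_commute)
      moreover have "{p, q, d, z} \<subseteq> V" "{p, y} \<subseteq> V" "y \<in> {p, y} - {p, q, d, z}"
        using ne False yz d pq by auto
      ultimately obtain f where f: "f \<in> sym_diff {p, q, d, z} {p, y}" "f \<noteq> y"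
        "matchable E (V - sym_diff {p, q, d, z} {y, f})"
        "matchable E (V - sym_diff {p, y} {y, f})"
        using matchable_exchange_compl[OF m, of "{p, y}" y] by blast
      consider "f = q" | "f = d" | "f = z" using f by auto
      then show False
      proof cases
        case 1
        then have "sym_diff {p, y} {y, f} = {p, q}" using ne p by auto
        then show False using f(4) pq by simp
      next
        case 2
        then have "sym_diff {p, q, d, z} {y, f} = {p, q, y, z}" using ne p False dz by auto
        then show False using f(3) nyz False by simp
      next
        case 3
        then have "sym_diff {p, q, d, z} {y, f} = {p, q, d, y}" using ne p False dz by auto
        then show False using f(3) step.IH False by simp
      qed
    qed
  qed
qed

text \<open>An edge leaving \<open>A\<close> stays within one class. Among the classes meeting both \<open>A\<close> and its
  complement, choose \<open>cls s\<close> and a component \<open>D s d\<close> of the rest, with the component as large as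
  possible; then no other component contains an edge leaving \<open>A\<close>. A perfect matching of \<open>V - {r, d}\<close> with
  \<open>r \<in> cls s\<close> pairs up \<open>V - A - D s d\<close> up to \<open>r\<close>, so the parity of this set would depend on the
  side on which \<open>r\<close> lies.\<close>

lemma allowed_connected:
  assumes A: "A \<subseteq> V" "A \<noteq> {}"
    and sep: "\<And>a b. a \<in> A \<Longrightarrow> b \<in> V - A \<Longrightarrow> {a, b} \<in> E \<Longrightarrow> \<not> matchable E (V - {a, b})"
  shows "A = V"
proof (rule ccontr)
  assume ne: "A \<noteq> V"
  define crossing where "crossing s \<longleftrightarrow> s \<in> V \<and> cls s \<inter> A \<noteq> {} \<and> cls s - A \<noteq> {}" for s
  define D where "D s d = (link (V - cls s))\<^sup>* `` {d}" for s d
  have D_closed: "q \<in> D s d" if "p \<in> D s d" "p \<in> V - cls s" "q \<in> V - cls s" "{p, q} \<in> E" for p q s d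
    using that by (auto simp: D_def link_def intro: rtrancl_into_rtrancl)
  have D_sub: "D s d \<subseteq> V - cls s" if "d \<in> V - cls s" for s d
  proof
    fix x assume "x \<in> D s d"
    then have "(d, x) \<in> (link (V - cls s))\<^sup>*" by (simp add: D_def)
    then show "x \<in> V - cls s" by (induction rule: rtrancl_induct) (use that in \<open>auto simp: link_def\<close>)
  qed
  have cross_edge: "b \<in> cls a" if "a \<in> A" "b \<in> V - A" "{a, b} \<in> E" for a b
    using sep[OF that] that by (auto simp: cls_def insert_commute)
  have cross_edge': "crossing a \<and> cls b = cls a" if "a \<in> A" "b \<in> V - A" "{a, b} \<in> E" for a b
    using cross_edge[OF that] cls_refl[of a] cls_eq[of a b] A that by (auto simp: crossing_def)
  obtain a b where ab: "a \<in> A" "b \<in> V - A" "{a, b} \<in> E"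
    using connected_verts[OF A ne] by auto
  \<comment> \<open>The partner of \<open>a\<close> in a perfect matching lies outside
    \<open>cls a\<close>, so \<open>(a, a')\<close> is an admissible pair and the maximum below
    exists.\<close>
  obtain a' where a': "a' \<in> V" "a' \<noteq> a" "matchable E (V - {a, a'})" "{a, a'} \<in> E"
  proof -
    obtain y where "y \<in> V" "y \<noteq> a" "{a, y} \<in> E" "matchable E (V - {a, y})"
      using matchable_mate[OF matchable_verts] ab A by blast
    then show ?thesis using that by blast
  qed
  have "a' \<in> V - cls a" using a' by (auto simp: cls_def insert_commute)
  then have "\<exists>p. (crossing (fst p) \<and> snd p \<in> V - cls (fst p)) \<and>
      (\<forall>q. crossing (fst q) \<and> snd q \<in> V - cls (fst q) \<longrightarrow>
        card (D (fst q) (snd q)) \<le> card (D (fst p) (snd p)))"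
    using cross_edge'[OF ab] D_sub finite_verts
    by (intro ex_has_greatest_nat[of _ "(a, a')" _ "Suc (card V)"])
      (auto intro!: le_imp_less_Suc card_mono)
  then obtain s d where sd: "crossing s" "d \<in> V - cls s"
    and max: "\<And>x y. crossing x \<Longrightarrow> y \<in> V - cls x \<Longrightarrow> card (D x y) \<le> card (D s d)"
    by (metis fst_conv snd_conv surj_pair)
  have sV: "s \<in> V" using sd by (simp add: crossing_def)
  have d_D: "d \<in> D s d" by (simp add: D_def)
  have s_cls: "s \<in> cls s" by (rule cls_refl[OF sV])
  \<comment> \<open>Otherwise \<open>cls x\<close> is a crossing class disjoint from
    \<open>cls s\<close> and from \<open>D s d\<close>. These two sets are joined by an edge, so
    both lie in one component of the complement of \<open>cls x\<close>, which is then larger than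
    \<open>D s d\<close>.\<close>
  have outside: "x \<in> D s d" if x: "x \<in> A" "y \<in> V - A" "{x, y} \<in> E" "x \<notin> cls s" for x y
  proof (rule ccontr)
    assume nx: "x \<notin> D s d"
    have xV: "x \<in> V" using x A by auto
    have disj: "cls s \<inter> cls x = {}"
      using cls_eq[OF sV] cls_eq[OF xV] cls_refl[OF xV] x(4) by blast
    have D_disj: "D s d \<inter> cls x = {}"
    proof (rule ccontr)
      assume "D s d \<inter> cls x \<noteq> {}"
      then obtain z where z: "z \<in> D s d" "z \<in> cls x" by auto
      then have "z \<noteq> x" using nx by auto
      then show False
        using D_closed[OF z(1), of x] cls_edge[OF z(2) xV] D_sub[OF sd(2)] z x xV nx by auto
    qed
    have sx: "s \<in> V - cls x" using s_cls sV disj by auto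
    obtain p q where pq: "p \<in> D s d" "q \<in> V - D s d" "{p, q} \<in> E"
      using connected_verts[of "D s d"] D_sub[OF sd(2)] d_D sV s_cls by blast
    have q: "q \<in> cls s" using D_closed[OF pq(1), of q] pq D_sub[OF sd(2)] by auto
    have C_sub: "c \<in> D x s" if "c \<in> cls s" for c
    proof (cases "c = s")
      case True then show ?thesis by (simp add: D_def)
    next
      case False
      have "c \<in> V - cls x" using that disj cls_subset by auto
      moreover have "{s, c} \<in> E" using cls_edge[OF that sV False] by (simp add: insert_commute)
      moreover have "s \<in> D x s" by (simp add: D_def)
      ultimately show ?thesis using D_closed sx by blast
    qed
    have "q \<in> V - cls x" "p \<in> V - cls x"
      using pq q disj D_disj D_sub[OF sd(2)] by auto
    moreover have "{q, p} \<in> E" using pq by (simp add: insert_commute)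
    ultimately have p_in: "p \<in> D x s" by (rule D_closed[OF C_sub[OF q]])
    have "z \<in> D s d \<and> z \<in> D x s" if "(p, z) \<in> (link (V - cls s))\<^sup>*" for z
      using that
    proof (induction rule: rtrancl_induct)
      case base then show ?case using pq p_in by simp
    next
      case (step y z)
      then have zD: "z \<in> D s d" using D_closed[of y s d z] by (auto simp: link_def)
      then show ?case
        using step D_closed[of y x s z] D_disj by (auto simp: link_def)
    qed
    moreover have "(p, z) \<in> (link (V - cls s))\<^sup>*" if "z \<in> D s d" for z
    proof -
      have "(d, p) \<in> (link (V - cls s))\<^sup>*" using pq by (simp add: D_def)
      then have "(p, d) \<in> (link (V - cls s))\<^sup>*" using sym_rtrancl[OF link_sym] by (meson symD)
      then show ?thesis using that by (simp add: D_def)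
    qed
    ultimately have "D s d \<subseteq> D x s" by auto
    moreover have "s \<in> D x s" "s \<notin> D s d" using C_sub s_cls D_sub[OF sd(2)] by auto
    ultimately have "D s d \<subset> D x s" by auto
    moreover have "finite (D x s)" using D_sub[OF sx] finite_verts finite_subset by blast
    ultimately have "card (D s d) < card (D x s)" by (simp add: psubset_card_mono)
    moreover have "crossing x" using cross_edge'[OF x(1-3)] by simp
    ultimately show False using max[OF _ sx] by fastforce
  qed
  let ?B = "V - A - D s d"
  have parity: "matchable E (?B - {r})" if r: "r \<in> cls s" for r
  proof -
    have rd: "r \<noteq> d" "r \<in> V" using r sd cls_subset by auto
    have "cls r = cls s" using cls_eq[OF sV r] .
    then have "d \<notin> cls r" using sd by simp
    then have m: "matchable E (V - {r, d})"
      using not_cls_matchable[of d r] sd by (auto simp: insert_commute)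
    have sub: "?B - {r} \<subseteq> V - {r, d}" using d_D by auto
    show ?thesis
    proof (rule matchable_restrict[OF m sub])
      fix t y assume t: "t \<in> ?B - {r}" and y: "y \<in> V - {r, d} - (?B - {r})" and e: "{t, y} \<in> E"
      have eq: "V - {r, d} - {t, y} = V - {r, d, t, y}" "V - {r, d, t, y} = V - {r, t, d, y}" by auto
      have e': "{y, t} \<in> E" using e by (simp add: insert_commute)
      \<comment> \<open>If \<open>t\<close> is in \<open>cls s\<close>, then either \<open>y\<close>
        is in \<open>D s d\<close> and the component barrier applies, or \<open>y\<close> is in
        \<open>A\<close>, hence in the same class, and the triple barrier applies. If
        \<open>t\<close> is not in \<open>cls s\<close>, the edge crosses into \<open>A\<close> away
        from \<open>cls s\<close> and \<open>D s d\<close>, against \<open>outside\<close>.\<close>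
      show "\<not> matchable E (V - {r, d} - {t, y})"
      proof (cases "t \<in> cls s")
        case True
        show ?thesis
        proof (cases "y \<in> D s d")
          case True
          then have "(d, y) \<in> (link (V - cls s))\<^sup>*" by (simp add: D_def)
          then have "\<not> matchable E (V - {r, t, d, y})"
            using component_barrier[OF sV r \<open>t \<in> cls s\<close> _ sd(2)] t y by auto
          then show ?thesis using eq by simp
        next
          case False
          then have "y \<in> A" using y t by auto
          then have "cls t = cls y" using cross_edge'[of y t] e' t by auto
          then have "y \<in> cls s" using cls_eq[OF sV True] cls_refl[of y] y by auto
          then have "\<not> matchable E (V - {r, d, t, y})"
            using cls_triple_barrier[OF sV _ _ _ _ sd(2), of r t y] r True t y \<open>y \<in> A\<close> by auto
          then show ?thesis using eq by simp
        qed
      next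
        case False
        have nD: "y \<notin> D s d"
          using D_closed[of y s d t] e' False t D_sub[OF sd(2)] by auto
        then have "y \<in> A" using y t by auto
        then have "cls t = cls y" using cross_edge'[of y t] e' t by auto
        moreover have "t \<in> cls t" using t cls_refl by auto
        ultimately have "y \<notin> cls s" using cls_eq[OF sV] False by auto
        then show ?thesis using outside[of y t] \<open>y \<in> A\<close> e' t nD by auto
      qed
    qed
  qed
  obtain r1 r2 where r: "r1 \<in> cls s" "r1 \<in> A" "r2 \<in> cls s" "r2 \<notin> A"
    using sd by (auto simp: crossing_def)
  have "?B - {r1} = ?B" using r by auto
  then have m1: "matchable E ?B" using parity[OF r(1)] by simp
  have "r2 \<in> ?B" using r cls_subset D_sub[OF sd(2)] by auto
  then have "card ?B = Suc (card (?B - {r2}))" by (rule card.remove[OF matchable_finite[OF m1]])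
  then show False using matchable_even[OF m1] matchable_even[OF parity[OF r(3)]] by simp
qed

end

lemma (in saturated_pair) saturated_equiv_base: "saturated_equiv E base"
proof -
  interpret core: saturated_pair E base by (rule saturated_pair_base)
  show ?thesis
  proof
    fix v u assume v: "v \<in> base" and "u \<in> core.cls v"
    then have "u \<in> cls v" "u \<in> base" using cls_base[OF v] by simp_all
    then show "core.cls u = core.cls v"
      using cls_base[OF v] cls_base[of u] base_mem_cls_eq[OF v, of u] by simp
  qed
qed

subsection \<open>Perfect matchings of graphs\<close>

lemma matchable_Union:
  assumes "finite M" "M \<subseteq> E" "\<forall>e\<in>M. card e = 2" "pairwise disjnt M"
  shows "matchable E (\<Union>M)"
  using assms
proof (induction M rule: finite_induct)
  case empty then show ?case by (simp add: matchable.empty)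
next
  case (insert e M)
  then obtain x y where e: "e = {x, y}" "x \<noteq> y" by (metis card_2_iff insertI1)
  have "e \<inter> \<Union>M = {}" 
    using insert.prems(3) insert.hyps(2) unfolding pairwise_insert disjnt_def by blast
  then have "matchable E (insert x (insert y (\<Union>M)))"
    using insert e by (intro matchable.insert) (auto simp: pairwise_insert)
  then show ?case using e by simp
qed

lemma matchable_obtain:
  assumes "matchable E X"
  obtains M where "M \<subseteq> E" "pairwise disjnt M" "\<Union>M = X"
proof -
  have "\<exists>M\<subseteq>E. pairwise disjnt M \<and> \<Union>M = X"
    using assms
  proof (induction rule: matchable.induct)
    case empty show ?case by (rule exI[of _ "{}"]) auto
  next
    case (insert X x y)
    then obtain M where "M \<subseteq> E" "pairwise disjnt M" "\<Union>M = X" by auto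
    then show ?case
      using insert.hyps
      by (intro exI[of _ "insert {x, y} M"]) (auto simp: pairwise_insert)
  qed
  then show ?thesis using that by blast
qed

lemma perfect_matching_iff:
  assumes "simple_graph G"
  shows "perfect_matching G M \<longleftrightarrow> M \<subseteq> gedges G \<and> pairwise disjnt M \<and> \<Union>M = gverts G"
    (is "_ \<longleftrightarrow> ?R")
proof
  assume p: "perfect_matching G M"
  then have M: "M \<subseteq> gedges G" "\<And>v. v \<in> gverts G \<Longrightarrow> \<exists>!e. e \<in> M \<and> v \<in> e"
    by (auto simp: perfect_matching_def)
  have sub: "\<Union>M \<subseteq> gverts G" using M(1) assms by (auto simp: simple_graph_def)
  have "pairwise disjnt M"
    unfolding pairwise_def disjnt_def using M(2) sub by blast
  then show ?R using M sub by blast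
next
  assume r: ?R
  have "\<exists>!e. e \<in> M \<and> v \<in> e" if "v \<in> gverts G" for v
    using that r unfolding pairwise_def disjnt_def by (metis UnionE disjoint_iff)
  then show "perfect_matching G M" using r by (simp add: perfect_matching_def)
qed

lemma simple_graph_edge:
  assumes "simple_graph G" "e \<in> gedges G"
  obtains x y where "e = {x, y}" "x \<noteq> y" "x \<in> gverts G" "y \<in> gverts G"
  using assms unfolding simple_graph_def by (metis card_2_iff insert_subset)

text \<open>Stated for a part \<open>N\<close> of the matching so that it also serves for a perfect
  matching with one edge left out.\<close>

lemma perfect_matching_matchable:
  assumes "simple_graph G" "perfect_matching G M" "N \<subseteq> M"
  shows "matchable (gedges G) (\<Union>N)"
proof (rule matchable_Union)
  have M: "M \<subseteq> gedges G" "pairwise disjnt M" "\<Union>M = gverts G"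
    using assms(2) perfect_matching_iff[OF assms(1)] by simp_all
  then have "finite (\<Union>M)" using assms by (simp add: simple_graph_def)
  then show "finite N" using assms(3) finite_UnionD finite_subset by blast
  show "N \<subseteq> gedges G" "\<forall>e\<in>N. card e = 2" "pairwise disjnt N"
    using M assms pairwise_subset by (auto simp: simple_graph_def)
qed

lemma factorizable_iff:
  assumes "simple_graph G"
  shows "factorizable G \<longleftrightarrow> matchable (gedges G) (gverts G)"
proof
  assume "factorizable G"
  then obtain M where M: "perfect_matching G M" by (auto simp: factorizable_def)
  then show "matchable (gedges G) (gverts G)"
    using perfect_matching_matchable[OF assms M order_refl] perfect_matching_iff[OF assms] by simp
next
  assume "matchable (gedges G) (gverts G)"
  then show "factorizable G"
    using perfect_matching_iff[OF assms] by (metis factorizable_def matchable_obtain)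
qed

lemma perfect_matching_containing_edge:
  assumes G: "simple_graph G" and e: "{x, y} \<in> gedges G"
  shows "(\<exists>M. perfect_matching G M \<and> {x, y} \<in> M) \<longleftrightarrow> matchable (gedges G) (gverts G - {x, y})"
proof
  assume "\<exists>M. perfect_matching G M \<and> {x, y} \<in> M"
  then obtain M where M: "perfect_matching G M" "{x, y} \<in> M" by auto
  have U: "pairwise disjnt M" "\<Union>M = gverts G" using perfect_matching_iff[OF G] M(1) by blast+
  have "e \<inter> {x, y} = {}" if "e \<in> M - {{x, y}}" for e
    using pairwiseD[OF U(1), of e "{x, y}"] that M(2) by (simp add: disjnt_def)
  then have "\<Union>(M - {{x, y}}) = \<Union>M - {x, y}"
    by (intro set_eqI) auto
  then have "\<Union>(M - {{x, y}}) = gverts G - {x, y}" using U(2) by simp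
  then show "matchable (gedges G) (gverts G - {x, y})"
    using perfect_matching_matchable[OF G M(1), of "M - {{x, y}}"] by auto
next
  assume "matchable (gedges G) (gverts G - {x, y})"
  then obtain M where M: "M \<subseteq> gedges G" "pairwise disjnt M" "\<Union>M = gverts G - {x, y}"
    by (rule matchable_obtain)
  have "perfect_matching G (insert {x, y} M)"
    using M e G by (auto simp: perfect_matching_iff pairwise_insert simple_graph_def)
  then show "\<exists>M. perfect_matching G M \<and> {x, y} \<in> M" by blast
qed

lemma allowed_edges_iff:
  assumes "simple_graph G"
  shows "{x, y} \<in> allowed_edges G \<longleftrightarrow>
    {x, y} \<in> gedges G \<and> matchable (gedges G) (gverts G - {x, y})"
  using perfect_matching_containing_edge[OF assms] by (auto simp: allowed_edges_def)

lemma simple_induced: "simple_graph G \<Longrightarrow> simple_graph (induced G X)"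
  by (auto simp: simple_graph_def induced_def)

lemma gverts_induced: "X \<subseteq> gverts G \<Longrightarrow> gverts (induced G X) = X"
  by (auto simp: induced_def)

lemma matchable_induced:
  assumes "Y \<subseteq> X"
  shows "matchable (gedges (induced G X)) Y \<longleftrightarrow> matchable (gedges G) Y"
proof
  assume "matchable (gedges (induced G X)) Y"
  then show "matchable (gedges G) Y" by (rule matchable_mono) (simp add: induced_def)
next
  assume "matchable (gedges G) Y"
  then show "matchable (gedges (induced G X)) Y"
    by (rule matchable_mono) (use assms in \<open>auto simp: induced_def\<close>)
qed

lemma factorizable_delete_verts:
  assumes "simple_graph G"
  shows "factorizable (delete_verts G X) \<longleftrightarrow> matchable (gedges G) (gverts G - X)"
  using factorizable_iff[OF simple_induced[OF assms], of "gverts G - X"]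
    matchable_induced[of "gverts G - X" "gverts G - X" G]
  by (simp add: delete_verts_def gverts_induced)

text \<open>The perfect matchings of \<open>G\<close> are those of \<open>G + xy\<close> that avoid
  \<open>xy\<close>. As there are finitely many, the number grows iff some perfect matching of
  \<open>G + xy\<close> uses \<open>xy\<close>.\<close>

lemma saturated_iff:
  assumes G: "simple_graph G"
  shows "saturated G \<longleftrightarrow> saturated_pair (gedges G) (gverts G)"
proof -
  have key: "card {M. perfect_matching G M} < card {M. perfect_matching (add_edge G x y) M} \<longleftrightarrow>
      matchable (gedges G) (gverts G - {x, y})"
    if xy: "x \<in> gverts G" "y \<in> gverts G" "x \<noteq> y" "{x, y} \<notin> gedges G" for x y
  proof -
    let ?H = "add_edge G x y"
    let ?P = "{M. perfect_matching G M}" and ?Q = "{M. perfect_matching ?H M}"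
    have H: "simple_graph ?H" "gverts ?H = gverts G" "gedges ?H = insert {x, y} (gedges G)"
      using G xy by (auto simp: simple_graph_def add_edge_def)
    have PQ: "?P = {M \<in> ?Q. {x, y} \<notin> M}"
      using xy by (auto simp: perfect_matching_def H)
    have "finite (Pow (gverts ?H))" using H(1) by (simp add: simple_graph_def)
    then have "finite (gedges ?H)"
      by (rule rev_finite_subset) (use H(1) in \<open>auto simp: simple_graph_def\<close>)
    then have fin: "finite ?Q"
      by (intro finite_subset[of ?Q "Pow (gedges ?H)"]) (auto simp: perfect_matching_def)
    have eq: "matchable (gedges ?H) (gverts G - {x, y}) \<longleftrightarrow>
        matchable (gedges G) (gverts G - {x, y})"
      by (auto elim!: matchable_mono simp: H)
    have ex: "(\<exists>M. perfect_matching ?H M \<and> {x, y} \<in> M) \<longleftrightarrow>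
        matchable (gedges G) (gverts G - {x, y})"
      using perfect_matching_containing_edge[OF H(1), of x y] H eq by simp
    have "card ?P < card ?Q \<longleftrightarrow> ?P \<noteq> ?Q"
    proof
      show "?P \<noteq> ?Q" if "card ?P < card ?Q" using that by auto
      show "card ?P < card ?Q" if "?P \<noteq> ?Q"
        using that PQ by (intro psubset_card_mono[OF fin]) blast
    qed
    also have "\<dots> \<longleftrightarrow> (\<exists>M. perfect_matching ?H M \<and> {x, y} \<in> M)" using PQ by blast
    finally show ?thesis using ex by simp
  qed
  show ?thesis
    unfolding saturated_def saturated_pair_def using key factorizable_iff[OF G] by blast
qed

lemma saturated_induced:
  assumes G: "simple_graph G" and X: "X \<subseteq> gverts G" and s: "saturated_pair (gedges G) X"
  shows "saturated (induced G X)"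
proof -
  have "saturated_pair (gedges (induced G X)) X"
  proof
    show "matchable (gedges (induced G X)) X"
      using saturated_pair.matchable_verts[OF s] matchable_induced[of X X G] by simp
    fix x y assume xy: "x \<in> X" "y \<in> X" "x \<noteq> y" "{x, y} \<notin> gedges (induced G X)"
    then have "{x, y} \<notin> gedges G" by (simp add: induced_def)
    then show "matchable (gedges (induced G X)) (X - {x, y})"
      using saturated_pair.saturated[OF s] xy matchable_induced[of "X - {x, y}" X G] by auto
  qed
  then show ?thesis using saturated_iff[OF simple_induced[OF G]] gverts_induced[OF X] by simp
qed

lemma simple_contract:
  assumes "simple_graph G"
  shows "simple_graph (contract G Y)"
proof -
  have "e' \<subseteq> gverts (contract G Y) \<and> card e' = 2" if e': "e' \<in> gedges (contract G Y)" for e'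
  proof -
    obtain e where e: "e' = (\<lambda>v. if v \<in> Y then None else Some v) ` e" "e \<in> gedges G" "\<not> e \<subseteq> Y"
      using e' by (auto simp: contract_def)
    obtain x y where xy: "e = {x, y}" "x \<noteq> y" "x \<in> gverts G" "y \<in> gverts G"
      using simple_graph_edge[OF assms e(2)] .
    have e'_eq: "e' = {if x \<in> Y then None else Some x, if y \<in> Y then None else Some y}"
      by (simp only: e(1) xy(1) image_insert image_empty)
    show ?thesis
      using xy e(3) unfolding e'_eq contract_def by (cases "x \<in> Y"; cases "y \<in> Y") simp_all
  qed
  then show ?thesis using assms by (auto simp: simple_graph_def contract_def)
qed

section \<open>Factor-connected components as reachability classes\<close>

text \<open>In a factorizable graph these are the vertex sets of the elementary components, hence
  also of the factor-connected ones.\<close>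

definition allowed_reach :: "'a ugraph \<Rightarrow> 'a \<Rightarrow> 'a set" where
  "allowed_reach G v = {(x, y). {x, y} \<in> allowed_edges G}\<^sup>* `` {v}"

text \<open>The edges of any one perfect matching are allowed and already cover all vertices, so the
  components of the allowed subgraph miss no vertex.\<close>

lemma Union_allowed_edges:
  assumes "simple_graph G" "factorizable G"
  shows "\<Union> (allowed_edges G) = gverts G"
proof -
  obtain M where M: "perfect_matching G M" using assms by (auto simp: factorizable_def)
  then have "M \<subseteq> allowed_edges G" "\<Union>M = gverts G"
    using perfect_matching_iff[OF assms(1)] by (auto simp: allowed_edges_def)
  moreover have "\<Union> (allowed_edges G) \<subseteq> gverts G"
    using assms by (auto simp: allowed_edges_def simple_graph_def)
  ultimately show ?thesis by (metis Union_mono subset_antisym)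
qed

lemma allowed_reach_subset:
  assumes "v \<in> gverts G" "simple_graph G"
  shows "allowed_reach G v \<subseteq> gverts G"
proof
  fix x assume "x \<in> allowed_reach G v"
  then have "(v, x) \<in> {(x, y). {x, y} \<in> allowed_edges G}\<^sup>*" by (simp add: allowed_reach_def)
  then show "x \<in> gverts G"
    by (induction rule: rtrancl_induct)
      (use assms in \<open>auto simp: allowed_edges_def simple_graph_def\<close>)
qed

lemma elementary_components_eq:
  assumes "simple_graph G" "factorizable G"
  shows "elementary_components G =
    (\<lambda>v. induced \<lparr>gverts = gverts G, gedges = allowed_edges G\<rparr> (allowed_reach G v)) ` gverts G"
proof -
  have "adjacency \<lparr>gverts = gverts G, gedges = allowed_edges G\<rparr> =
      {(x, y). {x, y} \<in> allowed_edges G}"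
    using assms by (auto simp: adjacency_def allowed_edges_def simple_graph_def)
  then show ?thesis
    by (auto simp: elementary_components_def Union_allowed_edges[OF assms] conn_components_def
      allowed_reach_def)
qed

lemma factor_components_eq:
  assumes "simple_graph G" "factorizable G"
  shows "factor_components G = (\<lambda>v. induced G (allowed_reach G v)) ` gverts G"
proof -
  have "gverts (induced \<lparr>gverts = gverts G, gedges = allowed_edges G\<rparr> (allowed_reach G v))
      = allowed_reach G v" if "v \<in> gverts G" for v
    using allowed_reach_subset[OF that assms(1)] by (auto simp: induced_def)
  then have "induced G (gverts (induced \<lparr>gverts = gverts G, gedges = allowed_edges G\<rparr>
      (allowed_reach G v))) = induced G (allowed_reach G v)" if "v \<in> gverts G" for v
    using that by simp
  then have "(\<lambda>H. induced G (gverts H)) ` elementary_components G =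
      (\<lambda>v. induced G (allowed_reach G v)) ` gverts G"
    unfolding elementary_components_eq[OF assms] image_image by (intro image_cong) simp_all
  then show ?thesis unfolding factor_components_def by blast
qed

lemma allowed_reach_eq:
  assumes "u \<in> allowed_reach G v"
  shows "allowed_reach G u = allowed_reach G v"
proof -
  let ?R = "{(x, y). {x, y} \<in> allowed_edges G}"
  have "sym ?R" by (auto simp: sym_def insert_commute)
  then have "sym (?R\<^sup>*)" by (rule sym_rtrancl)
  moreover have "(v, u) \<in> ?R\<^sup>*" using assms by (simp add: allowed_reach_def)
  ultimately have "(u, v) \<in> ?R\<^sup>*" by (meson symD)
  then show ?thesis
    using \<open>(v, u) \<in> ?R\<^sup>*\<close> by (auto simp: allowed_reach_def)
qed

lemma canonical_rel_Image:
  assumes "simple_graph G" "factorizable G" "v \<in> gverts G"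
  shows "canonical_rel G `` {v} =
    {u \<in> allowed_reach G v. u = v \<or> \<not> matchable (gedges G) (gverts G - {u, v})}"
proof -
  have "(\<exists>H\<in>factor_components G. v \<in> gverts H \<and> u \<in> gverts H) \<longleftrightarrow> u \<in> allowed_reach G v" for u
  proof
    assume "\<exists>H\<in>factor_components G. v \<in> gverts H \<and> u \<in> gverts H"
    then obtain w where "v \<in> allowed_reach G w" "u \<in> allowed_reach G w"
      unfolding factor_components_eq[OF assms(1,2)] by (auto simp: induced_def)
    then show "u \<in> allowed_reach G v" using allowed_reach_eq[of v G w] by simp
  next
    assume u: "u \<in> allowed_reach G v"
    have "v \<in> allowed_reach G v" by (simp add: allowed_reach_def)
    then show "\<exists>H\<in>factor_components G. v \<in> gverts H \<and> u \<in> gverts H"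
      using u assms allowed_reach_subset[OF assms(3,1)]
      by (auto simp: factor_components_eq[OF assms(1,2)] induced_def)
  qed
  moreover have "factorizable (delete_verts G {v, u}) \<longleftrightarrow>
      matchable (gedges G) (gverts G - {u, v})" for u
    using factorizable_delete_verts[OF assms(1)] by (simp add: insert_commute)
  ultimately show ?thesis by (auto simp: canonical_rel_def)
qed

subsection \<open>The cathedral structure\<close>

text \<open>A reachability class is left by no allowed edge, so \<open>allowed_connected\<close>
  makes it all of \<open>X\<close>.\<close>

lemma allowed_reach_equiv:
  assumes G: "simple_graph G" and X: "X \<subseteq> gverts G"
    and s: "saturated_equiv (gedges G) X" and v: "v \<in> X"
  shows "allowed_reach (induced G X) v = X"
proof (rule saturated_equiv.allowed_connected[OF s])
  have gv: "gverts (induced G X) = X" by (rule gverts_induced[OF X])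
  show "allowed_reach (induced G X) v \<subseteq> X"
    using allowed_reach_subset[OF _ simple_induced[OF G]] v gv by metis
  show "allowed_reach (induced G X) v \<noteq> {}" by (auto simp: allowed_reach_def)
  fix a b assume a: "a \<in> allowed_reach (induced G X) v"
    and b: "b \<in> X - allowed_reach (induced G X) v" and e: "{a, b} \<in> gedges G"
  have "a \<in> X" using \<open>allowed_reach (induced G X) v \<subseteq> X\<close> a by auto
  show "\<not> matchable (gedges G) (X - {a, b})"
  proof
    assume "matchable (gedges G) (X - {a, b})"
    moreover have "{a, b} \<in> gedges (induced G X)"
      using e b \<open>a \<in> X\<close> by (simp add: induced_def)
    ultimately have "{a, b} \<in> allowed_edges (induced G X)"
      by (simp add: allowed_edges_iff[OF simple_induced[OF G]] gv matchable_induced)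
    then have "b \<in> allowed_reach (induced G X) v"
      using a by (auto simp: allowed_reach_def intro: rtrancl_into_rtrancl)
    then show False using b by simp
  qed
qed

section \<open>The foundation as a factor-connected component\<close>

locale saturated_graph =
  fixes G :: "'a ugraph"
  assumes simple: "simple_graph G" and sat: "saturated G" and nonempty: "gverts G \<noteq> {}"
begin

abbreviation "E \<equiv> gedges G"
abbreviation "V \<equiv> gverts G"

sublocale saturated_pair E V
  using saturated_iff[OF simple] sat by simp

lemma factorizable: "factorizable G"
  using sat by (simp add: saturated_def)

definition foundation :: "'a ugraph" where
  "foundation = induced G base"

lemma gverts_foundation: "gverts foundation = base"
  by (simp add: foundation_def gverts_induced base_subset)

lemma simple_foundation: "simple_graph foundation"
  by (simp add: foundation_def simple_induced simple)

lemma saturated_foundation: "saturated foundation"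
  unfolding foundation_def by (rule saturated_induced[OF simple base_subset saturated_pair_base])

lemma factorizable_foundation: "factorizable foundation"
  using saturated_foundation by (simp add: saturated_def)

lemma matchable_foundation: "X \<subseteq> base \<Longrightarrow> matchable (gedges foundation) X \<longleftrightarrow> matchable E X"
  by (simp add: foundation_def matchable_induced)

lemma allowed_reach_foundation: "v \<in> base \<Longrightarrow> allowed_reach foundation v = base"
  unfolding foundation_def
  by (rule allowed_reach_equiv[OF simple base_subset saturated_equiv_base])

text \<open>No allowed edge leaves \<open>base\<close>. Conversely, an edge allowed in the
  foundation is allowed in \<open>G\<close>, because a matching of the rest of \<open>base\<close>
  extends by one of \<open>V - base\<close>.\<close>

lemma allowed_reach_base:
  assumes "v \<in> base"
  shows "allowed_reach G v = base"
proof
  show "allowed_reach G v \<subseteq> base"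
  proof
    fix x assume "x \<in> allowed_reach G v"
    then have "(v, x) \<in> {(x, y). {x, y} \<in> allowed_edges G}\<^sup>*" by (simp add: allowed_reach_def)
    then show "x \<in> base"
    proof (induction rule: rtrancl_induct)
      case base then show ?case by (rule assms)
    next
      case (step y z)
      then have e: "{y, z} \<in> E" "matchable E (V - {y, z})"
        using allowed_edges_iff[OF simple] by auto
      then have "z \<in> V" using simple by (auto simp: simple_graph_def)
      then show ?case
        using tower_base_edge_not_allowed[of z y] e step.IH by (auto simp: insert_commute)
    qed
  qed
  have "allowed_edges foundation \<subseteq> allowed_edges G"
  proof
    fix e assume e: "e \<in> allowed_edges foundation"
    then have "e \<in> gedges foundation" by (simp add: allowed_edges_def)
    then obtain x y where xy: "e = {x, y}" "x \<noteq> y" "x \<in> base" "y \<in> base"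
      using simple_graph_edge[OF simple_foundation] gverts_foundation by metis
    have "matchable (gedges foundation) (base - {x, y})"
      using e xy allowed_edges_iff[OF simple_foundation] gverts_foundation by simp
    then have "matchable E (base - {x, y})" by (simp add: matchable_foundation)
    then have "matchable E (V - {x, y})" using matchable_base_minus_two xy by simp
    then show "e \<in> allowed_edges G"
      using \<open>e \<in> gedges foundation\<close> xy allowed_edges_iff[OF simple]
      by (simp add: foundation_def induced_def)
  qed
  then have "{(x, y). {x, y} \<in> allowed_edges foundation} \<subseteq> {(x, y). {x, y} \<in> allowed_edges G}"
    by auto
  then have "allowed_reach foundation v \<subseteq> allowed_reach G v"
    unfolding allowed_reach_def by (intro Image_mono rtrancl_mono) auto
  then show "base \<subseteq> allowed_reach G v" using allowed_reach_foundation[OF assms] by simp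
qed

lemma elementary_foundation: "elementary foundation"
proof -
  have "elementary_components foundation =
      {induced \<lparr>gverts = base, gedges = allowed_edges foundation\<rparr> base}"
    unfolding elementary_components_eq[OF simple_foundation factorizable_foundation]
      gverts_foundation
    using base_nonempty[OF nonempty] allowed_reach_foundation by auto
  then show ?thesis by (simp add: elementary_def factorizable_foundation)
qed

lemma foundation_factor_component: "foundation \<in> factor_components G"
proof -
  obtain v where "v \<in> base" using base_nonempty[OF nonempty] by auto
  then show ?thesis
    unfolding factor_components_eq[OF simple factorizable] foundation_def
    using allowed_reach_base base_subset by (intro image_eqI[of _ _ v]) auto
qed

lemma canonical_rel_foundation:
  assumes "v \<in> base"
  shows "canonical_rel foundation `` {v} = cls v \<inter> base"
proof -
  have "canonical_rel foundation `` {v} = {u \<in> base. u = v \<or> \<not> matchable E (base - {u, v})}"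
    using canonical_rel_Image[OF simple_foundation factorizable_foundation] assms
    by (simp add: gverts_foundation allowed_reach_foundation matchable_foundation)
  then show ?thesis
    using assms matchable_base_minus_two[of _ v] base_subset by (auto simp: cls_def)
qed

lemma canonical_rel_base:
  assumes "v \<in> base"
  shows "canonical_rel G `` {v} = cls v \<inter> base"
  using canonical_rel_Image[OF simple factorizable, of v] assms base_subset
  by (auto simp: allowed_reach_base cls_def)

lemma canonical_partition_foundation:
  "canonical_partition foundation = (\<lambda>v. cls v \<inter> base) ` base"
  unfolding canonical_partition_def quotient_def gverts_foundation
  using canonical_rel_foundation by auto

lemma canonical_partition_on_foundation:
  "canonical_partition_on G foundation = canonical_partition foundation"
proof -
  have self: "v \<in> canonical_rel G `` {v}" if "v \<in> V" for v
    using canonical_rel_Image[OF simple factorizable that] by (simp add: allowed_reach_def)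
  have "canonical_partition_on G foundation =
      {S. \<exists>v\<in>V. S = canonical_rel G `` {v} \<and> S \<subseteq> base}"
    unfolding canonical_partition_on_def canonical_partition_def quotient_def gverts_foundation
    by auto
  \<comment> \<open>Every class contains its representative, so a class inside \<open>base\<close>
    is represented there.\<close>
  also have "\<dots> = {S. \<exists>v\<in>base. S = canonical_rel G `` {v} \<and> S \<subseteq> base}"
    using self base_subset by blast
  also have "\<dots> = (\<lambda>v. cls v \<inter> base) ` base"
    using canonical_rel_base by auto
  finally show ?thesis using canonical_partition_foundation by simp
qed

section \<open>Towers as components above the foundation\<close>

text \<open>A walk avoiding \<open>base\<close> cannot leave the tower, and the set it reaches is
  closed in the tower, hence all of it.\<close>

lemma component_above_base:
  assumes u: "u \<in> base" and t: "t \<in> cls u - base"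
  shows "(adjacency (delete_verts G base))\<^sup>* `` {t} = cls u - base"
proof -
  let ?R = "adjacency (delete_verts G base)"
  have R: "(x, y) \<in> ?R \<longleftrightarrow> x \<in> V - base \<and> y \<in> V - base \<and> {x, y} \<in> E" for x y
    by (auto simp: adjacency_def delete_verts_def induced_def)
  have sub: "?R\<^sup>* `` {t} \<subseteq> cls u - base"
  proof
    fix x assume "x \<in> ?R\<^sup>* `` {t}"
    then have "(t, x) \<in> ?R\<^sup>*" by simp
    then show "x \<in> cls u - base"
    proof (induction rule: rtrancl_induct)
      case base then show ?case by (rule t)
    next
      case (step y z)
      then show ?case using tower_neighbour[OF u step.IH, of z] R by auto
    qed
  qed
  show ?thesis
  proof (rule tower_connected[OF u sub])
    fix x y assume "x \<in> ?R\<^sup>* `` {t}" "y \<in> cls u - base - ?R\<^sup>* `` {t}"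
    moreover from this have "x \<in> V - base" "y \<in> V - base" using sub cls_subset by auto
    ultimately show "{x, y} \<notin> E" using R[of x y] by (auto intro: rtrancl_into_rtrancl)
  qed auto
qed

lemma components_above_base:
  "conn_components (delete_verts G base) =
    {induced G (cls u - base) | u. u \<in> base \<and> cls u - base \<noteq> {}}"
proof -
  have ind: "induced (delete_verts G base) (cls u - base) = induced G (cls u - base)" for u
    using cls_subset[of u] by (auto simp: delete_verts_def induced_def)
  have gv: "gverts (delete_verts G base) = V - base"
    by (auto simp: delete_verts_def induced_def)
  show ?thesis
  proof (intro set_eqI iffI)
    fix K assume "K \<in> conn_components (delete_verts G base)"
    then obtain t where t: "t \<in> V - base"
      "K = induced (delete_verts G base) ((adjacency (delete_verts G base))\<^sup>* `` {t})"
      using gv by (auto simp: conn_components_def)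
    obtain u where u: "u \<in> base" "t \<in> cls u" using cls_base_cover t by auto
    then have "K = induced G (cls u - base)"
      using t component_above_base[OF u(1)] ind by simp
    then show "K \<in> {induced G (cls u - base) | u. u \<in> base \<and> cls u - base \<noteq> {}}"
      using u t by blast
  next
    fix K assume "K \<in> {induced G (cls u - base) | u. u \<in> base \<and> cls u - base \<noteq> {}}"
    then obtain u t where u: "u \<in> base" "t \<in> cls u - base" "K = induced G (cls u - base)"
      by blast
    then have "K = induced (delete_verts G base) ((adjacency (delete_verts G base))\<^sup>* `` {t})"
      using component_above_base[OF u(1,2)] ind by simp
    moreover have "t \<in> gverts (delete_verts G base)" using u cls_subset gv by auto
    ultimately show "K \<in> conn_components (delete_verts G base)"
      by (auto simp: conn_components_def)
  qed
qed

text \<open>A nonempty tower over the class of \<open>w\<close> has \<open>w\<close> as a neighbour,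
  so a neighbourhood inside the block of \<open>u\<close> forces
  \<open>cls w = cls u\<close>.\<close>

lemma tower_component_iff:
  assumes u: "u \<in> base"
  shows "tower_component G foundation (cls u \<inter> base) K \<longleftrightarrow>
    K = induced G (cls u - base) \<and> cls u - base \<noteq> {}"
proof
  assume "tower_component G foundation (cls u \<inter> base) K"
  then obtain w where w: "w \<in> base" "K = induced G (cls w - base)" "cls w - base \<noteq> {}"
    and n: "neighbours G (gverts K) \<subseteq> cls u \<inter> base"
    unfolding tower_component_def gverts_foundation components_above_base by blast
  have gK: "gverts K = cls w - base" using w cls_subset by (auto simp: induced_def)
  obtain t where t: "t \<in> cls w - base" using w by auto
  have "w \<in> cls w" using cls_refl w base_subset by auto
  then have "{t, w} \<in> E" using class_base_edge(1)[OF w(1), of t w] t w by auto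
  then have "w \<in> neighbours G (gverts K)"
    using t w gK base_subset by (auto simp: neighbours_def insert_commute)
  then have "w \<in> cls u" using n by auto
  then have "cls w = cls u" using base_mem_cls_eq[OF u] w by simp
  then show "K = induced G (cls u - base) \<and> cls u - base \<noteq> {}" using w by simp
next
  assume K: "K = induced G (cls u - base) \<and> cls u - base \<noteq> {}"
  then have gK: "gverts K = cls u - base" using cls_subset by (auto simp: induced_def)
  have "neighbours G (gverts K) \<subseteq> cls u \<inter> base"
  proof
    fix v assume "v \<in> neighbours G (gverts K)"
    then obtain t where t: "t \<in> cls u - base" "v \<in> V" "v \<notin> cls u - base" "{t, v} \<in> E"
      unfolding gK by (auto simp: neighbours_def insert_commute)
    then show "v \<in> cls u \<inter> base" using tower_neighbour[OF u t(1,2,4)] by auto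
  qed
  then show "tower_component G foundation (cls u \<inter> base) K"
    unfolding tower_component_def gverts_foundation components_above_base using K u by blast
qed

lemma tower_eq:
  assumes u: "u \<in> base"
  shows "tower G foundation (cls u \<inter> base) = induced G (cls u - base)"
proof (cases "cls u - base = {}")
  case True
  then have "tower G foundation (cls u \<inter> base) = empty_graph"
    using tower_component_iff[OF u] by (simp add: tower_def)
  moreover have "induced G {} = empty_graph"
    using simple by (auto simp: induced_def empty_graph_def simple_graph_def)
  ultimately show ?thesis unfolding True by simp
next
  case False
  then have "tower_component G foundation (cls u \<inter> base) = (\<lambda>K. K = induced G (cls u - base))"
    using tower_component_iff[OF u] by (intro ext) simp
  then show ?thesis by (simp add: tower_def)
qed

lemma gverts_tower: "u \<in> base \<Longrightarrow> gverts (tower G foundation (cls u \<inter> base)) = cls u - base"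
  using cls_subset by (auto simp: tower_eq induced_def)

section \<open>Reassembly by the cathedral construction\<close>

lemma cathedral_data_foundation: "cathedral_data foundation (tower G foundation)"
proof -
  have sat: "saturated (induced G (cls u - base))" if u: "u \<in> base" for u
  proof (rule saturated_induced[OF simple])
    show "cls u - base \<subseteq> V" using cls_subset by auto
    show "saturated_pair E (cls u - base)"
    proof
      show "matchable E (cls u - base)" by (rule matchable_tower[OF u])
      fix x y assume xy: "x \<in> cls u - base" "y \<in> cls u - base" "x \<noteq> y" "{x, y} \<notin> E"
      then have "matchable E (V - {x, y})" using saturated[of x y] cls_subset by auto
      then show "matchable E (cls u - base - {x, y})" by (rule tower_split[OF u xy(1,2)])
    qed
  qed
  have disj: "(cls u - base) \<inter> (cls w - base) = {}"
    if "u \<in> base" "w \<in> base" "cls u \<inter> base \<noteq> cls w \<inter> base" for u w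
    using cls_base_eq that by blast
  show ?thesis
    unfolding cathedral_data_def canonical_partition_foundation ball_simps
  proof (intro conjI ballI impI)
    fix u assume u: "u \<in> base"
    show "simple_graph (tower G foundation (cls u \<inter> base))"
      "saturated (tower G foundation (cls u \<inter> base))"
      "gverts (tower G foundation (cls u \<inter> base)) \<inter> gverts foundation = {}"
      using sat[OF u] by (auto simp: gverts_tower[OF u] gverts_foundation)
        (simp_all add: tower_eq[OF u] simple_induced simple)
    fix w assume w: "w \<in> base" "cls u \<inter> base \<noteq> cls w \<inter> base"
    then show "gverts (tower G foundation (cls u \<inter> base)) \<inter>
        gverts (tower G foundation (cls w \<inter> base)) = {}"
      using disj[OF u w] by (simp add: gverts_tower u)
  qed (rule simple_foundation saturated_foundation elementary_foundation)+
qed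

text \<open>An edge with an end in a tower stays in the class of that tower, so the construction
  misses no edge. It adds none, since base and tower vertices of one class are related and hence
  adjacent.\<close>

lemma cathedral_foundation: "G = cathedral foundation (tower G foundation)"
proof -
  have "gverts (cathedral foundation (tower G foundation)) = base \<union> (\<Union>u\<in>base. cls u - base)"
    by (simp add: cathedral_def canonical_partition_foundation gverts_foundation gverts_tower)
  also have "\<dots> = V"
  proof
    show "base \<union> (\<Union>u\<in>base. cls u - base) \<subseteq> V" using base_subset cls_subset by auto
    show "V \<subseteq> base \<union> (\<Union>u\<in>base. cls u - base)"
    proof
      fix x assume "x \<in> V"
      then obtain u where "u \<in> base" "x \<in> cls u" by (rule cls_base_cover)
      then show "x \<in> base \<union> (\<Union>u\<in>base. cls u - base)" by auto
    qed
  qed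
  finally have verts: "gverts (cathedral foundation (tower G foundation)) = V" .
  have joins: "{{s, t} | s t S. S \<in> (\<lambda>v. cls v \<inter> base) ` base \<and> s \<in> S
      \<and> t \<in> gverts (tower G foundation S)} =
      {{s, t} | s t. \<exists>u\<in>base. s \<in> cls u \<inter> base \<and> t \<in> cls u - base}"
    by (intro set_eqI iffI) (fastforce simp: gverts_tower)+
  have edges: "gedges (cathedral foundation (tower G foundation)) =
      {e \<in> E. e \<subseteq> base} \<union> (\<Union>u\<in>base. {e \<in> E. e \<subseteq> cls u - base}) \<union>
      {{s, t} | s t. \<exists>u\<in>base. s \<in> cls u \<inter> base \<and> t \<in> cls u - base}"
    unfolding cathedral_def canonical_partition_foundation joins
    by (simp add: tower_eq) (simp add: foundation_def induced_def)
  have "e \<in> E \<longleftrightarrow> e \<in> gedges (cathedral foundation (tower G foundation))" for e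
  proof
    assume e: "e \<in> E"
    then obtain x y where xy: "e = {x, y}" "x \<noteq> y" "x \<in> V" "y \<in> V"
      using simple_graph_edge[OF simple] by blast
    have *: "{a, b} \<in> gedges (cathedral foundation (tower G foundation))"
      if ab: "{a, b} \<in> E" "a \<in> V - base" "b \<in> V" for a b
    proof -
      obtain u where u: "u \<in> base" "a \<in> cls u" using cls_base_cover ab by auto
      have b: "b \<in> cls u" using tower_neighbour[OF u(1), of a b] u ab by auto
      show ?thesis
      proof (cases "b \<in> base")
        case True
        then have "\<exists>s t. {a, b} = {s, t} \<and> (\<exists>u\<in>base. s \<in> cls u \<inter> base \<and> t \<in> cls u - base)"
          using u b ab by (intro exI[of _ b] exI[of _ a]) (auto simp: insert_commute)
        then show ?thesis unfolding edges by simp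
      next
        case False
        then have "{a, b} \<subseteq> cls u - base" using u b ab by auto
        then show ?thesis unfolding edges using u ab by blast
      qed
    qed
    show "e \<in> gedges (cathedral foundation (tower G foundation))"
    proof (cases "x \<in> base \<and> y \<in> base")
      case True
      then show ?thesis unfolding edges using e xy by simp
    next
      case False
      then show ?thesis using *[of x y] *[of y x] e xy by (auto simp: insert_commute)
    qed
  next
    assume "e \<in> gedges (cathedral foundation (tower G foundation))"
    moreover have "{s, t} \<in> E" if "u \<in> base" "s \<in> cls u \<inter> base" "t \<in> cls u - base" for s t u
      using class_base_edge(1)[of u t s] that by (auto simp: insert_commute)
    ultimately show "e \<in> E" unfolding edges by blast
  qed
  then have "gedges (cathedral foundation (tower G foundation)) = E" by blast
  then show ?thesis using verts by simp
qed

section \<open>Minimality of the foundation\<close>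

lemma minimum_foundation: "minimum_component G foundation"
proof -
  let ?C = "contract G base"
  have indV: "induced G V = G"
    using simple by (cases G) (auto simp: induced_def simple_graph_def)
  have verts: "gverts ?C = insert None (Some ` (V - base))" by (simp add: contract_def)
  have img: "Some ` e \<in> gedges ?C" if e: "e \<in> E" "e \<subseteq> V - base" for e
  proof -
    have "e \<noteq> {}" using e simple by (auto simp: simple_graph_def)
    then have "\<not> e \<subseteq> base" using e by auto
    moreover have "Some ` e = (\<lambda>v. if v \<in> base then None else Some v) ` e"
      using e by (intro image_cong) auto
    ultimately show ?thesis using e unfolding contract_def by auto
  qed
  have match: "matchable (gedges ?C) (Some ` X)" if "matchable E X" "X \<subseteq> V - base" for X
    using that img by (intro matchable_image[of E]) auto
  have "factor_critical ?C"
    unfolding factor_critical_def factorizable_delete_verts[OF simple_contract[OF simple]]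
  proof
    fix v assume "v \<in> gverts ?C"
    then consider "v = None" | x where "v = Some x" "x \<in> V - base" using verts by auto
    then show "matchable (gedges ?C) (gverts ?C - {v})"
    proof cases
      case 1
      then have "gverts ?C - {v} = Some ` (V - base)" using verts by auto
      then show ?thesis using match[OF matchable_compl_base] by simp
    next
      case 2
      \<comment> \<open>Deleting \<open>x\<close> frees its partner \<open>y\<close>. As
        \<open>y\<close> has a neighbour \<open>u\<close> in \<open>base\<close>, the contracted
        vertex \<open>None\<close> can be matched with \<open>y\<close>.\<close>
      obtain y where y: "y \<in> V - base" "y \<noteq> x" "matchable E (V - base - {x, y})"
        using matchable_mate[OF matchable_compl_base 2(2)] by metis
      obtain u where u: "u \<in> base" "y \<in> cls u" using cls_base_cover y by auto
      have "{y, u} \<in> E"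
        using class_base_edge(1)[OF u(1,2)] cls_refl[of u] u y base_subset by auto
      moreover have "(\<lambda>v. if v \<in> base then None else Some v) ` {y, u} = {None, Some y}"
        using u y by auto
      moreover have "\<not> {y, u} \<subseteq> base" using y by simp
      ultimately have "\<exists>e. {None, Some y} = (\<lambda>v. if v \<in> base then None else Some v) ` e \<and>
          e \<in> E \<and> \<not> e \<subseteq> base" by (intro exI[of _ "{y, u}"]) simp
      then have "{None, Some y} \<in> gedges ?C" unfolding contract_def by simp
      moreover have "matchable (gedges ?C) (Some ` (V - base - {x, y}))"
        using match[OF y(3)] by auto
      ultimately have "matchable (gedges ?C)
          (insert None (insert (Some y) (Some ` (V - base - {x, y}))))"
        by (intro matchable.insert) auto
      moreover have "insert None (insert (Some y) (Some ` (V - base - {x, y}))) = gverts ?C - {v}"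
        using verts 2 y by auto
      ultimately show ?thesis by simp
    qed
  qed
  moreover have sub: "gverts H \<subseteq> V" if "H \<in> factor_components G" for H
    using that by (auto simp: factor_components_def induced_def)
  then have "separating G V" by (simp add: separating_def)
  ultimately have "(foundation, H) \<in> cathedral_order G" if "H \<in> factor_components G" for H
    using that sub foundation_factor_component base_subset
    unfolding cathedral_order_def by (auto simp: indV gverts_foundation intro!: exI[of _ V])
  then show ?thesis using foundation_factor_component by (simp add: minimum_component_def)
qed

end

theorem theorem7:
  fixes G :: "'a ugraph"
  assumes "simple_graph G" and "gverts G \<noteq> {}" and "saturated G"
  shows "\<exists>G0. minimum_component G G0 \<and>
    canonical_partition_on G G0 = canonical_partition G0 \<and>
    (\<forall>S\<in>canonical_partition G0. \<exists>\<^sub>\<le>\<^sub>1K. tower_component G G0 S K) \<and>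
    obtained_by_cathedral G G0 (tower G G0)"
proof -
  interpret saturated_graph G using assms by unfold_locales
  have "\<exists>\<^sub>\<le>\<^sub>1K. tower_component G foundation S K" if "S \<in> canonical_partition foundation" for S
    using that tower_component_iff unfolding canonical_partition_foundation Uniq_def by auto
  moreover have "obtained_by_cathedral G foundation (tower G foundation)"
    unfolding obtained_by_cathedral_def
    using cathedral_data_foundation cathedral_foundation by blast
  ultimately show ?thesis
    using minimum_foundation canonical_partition_on_foundation by blast
qed

end
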